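(* Let $\mathcal{D}=(D,<,\approx)$, where $D$ is an infinite set, $<$ is a strict total order on $D$, and $\approx$ is equality. Then the satisfiability problems for $\mathrm{LRC}(\mathcal{D})$ and for $\mathrm{LRC}^{\top}(\mathcal{D})$ are undecidable.
   Context: Variables range over a countably infinite set $V$. A model is an infinite sequence $\sigma$ of maps $V\to D$. A formula $\phi$ is satisfiable iff $\sigma,0\models\phi$ for some model $\sigma$. $\mathrm{LRC}^{\top}(\mathcal{D})$ formulas are given by $\phi::= x\approx\mathbf{X}^iy \mid x\approx\mathbf{XF}y \mid x\approx\mathbf{XF}^{-1}y \mid x<\mathbf{XF}y \mid x>\mathbf{XF}y \mid \phi\wedge\phi\mid\neg\phi\mid\mathbf{X}\phi\mid\phi\mathbf{U}\phi$, with $x,y\in V$ and $i\in\mathbb{N}$. $\mathrm{LRC}(\mathcal{D})$ formulas are given by $\phi::= x\approx\mathbf{X}^iy \mid x\approx\langle\phi?\rangle y \mid x\approx\langle\phi?\rangle^{-1}y \mid x<\mathbf{XF}y \mid x>\mathbf{XF}y \mid \phi\wedge\phi\mid\neg\phi\mid\mathbf{X}\phi\mid\phi\mathbf{U}\phi\mid\mathbf{X}^{-1}\phi\mid\phi\mathbf{S}\phi$. Semantics: - $\sigma,i\models x\approx\mathbf{X}^jy$ iff $\sigma(i)(x)=\sigma(i+j)(y)$. - $\sigma,i\models x\approx\mathbf{XF}y$ iff there is $j>i$ with $\sigma(i)(x)=\sigma(j)(y)$. - $\sigma,i\models x\approx\mathbf{XF}^{-1}y$ iff there is $0\le j<i$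 with $\sigma(i)(x)=\sigma(j)(y)$. - $\sigma,i\models x<\mathbf{XF}y$ iff there is $j>i$ with $\sigma(i)(x)<\sigma(j)(y)$. - $\sigma,i\models x>\mathbf{XF}y$ iff there is $j>i$ with $\sigma(i)(x)>\sigma(j)(y)$. - $\sigma,i\models x\approx\langle\psi?\rangle y$ iff there is $j>i$ with $\sigma(i)(x)=\sigma(j)(y)$ and $\sigma,j\models\psi$. - $\sigma,i\models x\approx\langle\psi?\rangle^{-1}y$ iff there is $0\le j<i$ with $\sigma(i)(x)=\sigma(j)(y)$ and $\sigma,j\models\psi$. - Boolean connectives and $\mathbf{X},\mathbf{U}$ are as in LTL. - $\sigma,i\models\mathbf{X}^{-1}\phi$ iff $i\ge1$ and $\sigma,i-1\models\phi$. - $\sigma,i\models\phi\mathbf{S}\phi'$ iff there is $j\le i$ with $\sigma,j\models\phi'$ and $\sigma,k\models\phi$ for all $j<k\le i$. *)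

theory Defs
  imports Main "HOL-Library.Nat_Bijection"
begin

datatype recf =
    Zero
  | Succ
  | Proj nat
  | Comp recf "recf list"
  | Prec recf recf
  | Minim recf

inductive reval :: "recf \<Rightarrow> nat list \<Rightarrow> nat \<Rightarrow> bool" where
  zero: "reval Zero xs 0"
| succ: "reval Succ (x # xs) (Suc x)"
| proj: "i < length xs \<Longrightarrow> reval (Proj i) xs (xs ! i)"
| comp: "list_all2 (\<lambda>g y. reval g xs y) gs ys \<Longrightarrow> reval f ys z \<Longrightarrow> reval (Comp f gs) xs z"
| prec0: "reval f xs z \<Longrightarrow> reval (Prec f g) (0 # xs) z"
| precS: "reval (Prec f g) (n # xs) y \<Longrightarrow> reval g (n # y # xs) z \<Longrightarrow> reval (Prec f g) (Suc n # xs) z"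
| minim: "reval f (n # xs) 0 \<Longrightarrow> (\<forall>m<n. \<exists>y. reval f (m # xs) y \<and> 0 < y)
          \<Longrightarrow> reval (Minim f) xs n"

text \<open>A predicate P on a type with an injective encoding enc into nat is decidable iff
  some (total on codes) recursive function computes its characteristic function.\<close>
definition decidable_pred :: "('a \<Rightarrow> nat) \<Rightarrow> ('a \<Rightarrow> bool) \<Rightarrow> bool" where
  "decidable_pred enc P \<longleftrightarrow> (\<exists>f. \<forall>a. reval f [enc a] (if P a then 1 else 0))"

section \<open>Syntax (variables V = nat, countably infinite)\<close>

datatype lrct =
    TEqXi nat nat nat      (* x \<approx> X^i y  : TEqXi x i y *)
  | TEqXF nat nat
  | TEqXFinv nat nat
  | TLtXF nat nat
  | TGtXF nat nat
  | TAnd lrct lrct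
  | TNot lrct
  | TNext lrct
  | TUntil lrct lrct

datatype lrc =
    EqXi nat nat nat       (* x \<approx> X^i y : EqXi x i y *)
  | EqTest nat lrc nat
  | EqTestInv nat lrc nat
  | LtXF nat nat
  | GtXF nat nat
  | And lrc lrc
  | Not lrc
  | Next lrc
  | Until lrc lrc
  | Prev lrc
  | Since lrc lrc

primrec holds_t :: "(nat \<Rightarrow> nat \<Rightarrow> 'd::linorder) \<Rightarrow> nat \<Rightarrow> lrct \<Rightarrow> bool" where
  "holds_t \<sigma> i (TEqXi x k y) = (\<sigma> i x = \<sigma> (i + k) y)"
| "holds_t \<sigma> i (TEqXF x y) = (\<exists>j>i. \<sigma> i x = \<sigma> j y)"
| "holds_t \<sigma> i (TEqXFinv x y) = (\<exists>j<i. \<sigma> i x = \<sigma> j y)"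
| "holds_t \<sigma> i (TLtXF x y) = (\<exists>j>i. \<sigma> i x < \<sigma> j y)"
| "holds_t \<sigma> i (TGtXF x y) = (\<exists>j>i. \<sigma> i x > \<sigma> j y)"
| "holds_t \<sigma> i (TAnd \<phi> \<psi>) = (holds_t \<sigma> i \<phi> \<and> holds_t \<sigma> i \<psi>)"
| "holds_t \<sigma> i (TNot \<phi>) = (\<not> holds_t \<sigma> i \<phi>)"
| "holds_t \<sigma> i (TNext \<phi>) = holds_t \<sigma> (Suc i) \<phi>"
| "holds_t \<sigma> i (TUntil \<phi> \<psi>) =
     (\<exists>j\<ge>i. holds_t \<sigma> j \<psi> \<and> (\<forall>k. i \<le> k \<and> k < j \<longrightarrow> holds_t \<sigma> k \<phi>))"

primrec holds :: "(nat \<Rightarrow> nat \<Rightarrow> 'd::linorder) \<Rightarrow> nat \<Rightarrow> lrc \<Rightarrow> bool" where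
  "holds \<sigma> i (EqXi x k y) = (\<sigma> i x = \<sigma> (i + k) y)"
| "holds \<sigma> i (EqTest x \<psi> y) = (\<exists>j>i. \<sigma> i x = \<sigma> j y \<and> holds \<sigma> j \<psi>)"
| "holds \<sigma> i (EqTestInv x \<psi> y) = (\<exists>j<i. \<sigma> i x = \<sigma> j y \<and> holds \<sigma> j \<psi>)"
| "holds \<sigma> i (LtXF x y) = (\<exists>j>i. \<sigma> i x < \<sigma> j y)"
| "holds \<sigma> i (GtXF x y) = (\<exists>j>i. \<sigma> i x > \<sigma> j y)"
| "holds \<sigma> i (And \<phi> \<psi>) = (holds \<sigma> i \<phi> \<and> holds \<sigma> i \<psi>)"
| "holds \<sigma> i (Not \<phi>) = (\<not> holds \<sigma> i \<phi>)"
| "holds \<sigma> i (Next \<phi>) = holds \<sigma> (Suc i) \<phi>"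
| "holds \<sigma> i (Until \<phi> \<psi>) =
     (\<exists>j\<ge>i. holds \<sigma> j \<psi> \<and> (\<forall>k. i \<le> k \<and> k < j \<longrightarrow> holds \<sigma> k \<phi>))"
| "holds \<sigma> i (Prev \<phi>) = (1 \<le> i \<and> holds \<sigma> (i - 1) \<phi>)"
| "holds \<sigma> i (Since \<phi> \<psi>) =
     (\<exists>j\<le>i. holds \<sigma> j \<psi> \<and> (\<forall>k. j < k \<and> k \<le> i \<longrightarrow> holds \<sigma> k \<phi>))"

definition sat_t :: "'d::linorder itself \<Rightarrow> lrct \<Rightarrow> bool" where
  "sat_t _ \<phi> \<longleftrightarrow> (\<exists>\<sigma> :: nat \<Rightarrow> nat \<Rightarrow> 'd. holds_t \<sigma> 0 \<phi>)"

definition sat :: "'d::linorder itself \<Rightarrow> lrc \<Rightarrow> bool" where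
  "sat _ \<phi> \<longleftrightarrow> (\<exists>\<sigma> :: nat \<Rightarrow> nat \<Rightarrow> 'd. holds \<sigma> 0 \<phi>)"

definition enc3 :: "nat \<Rightarrow> nat \<Rightarrow> nat \<Rightarrow> nat" where
  "enc3 a b c = prod_encode (a, prod_encode (b, c))"

primrec code_t :: "lrct \<Rightarrow> nat" where
  "code_t (TEqXi x k y) = prod_encode (0, enc3 x k y)"
| "code_t (TEqXF x y) = prod_encode (1, prod_encode (x, y))"
| "code_t (TEqXFinv x y) = prod_encode (2, prod_encode (x, y))"
| "code_t (TLtXF x y) = prod_encode (3, prod_encode (x, y))"
| "code_t (TGtXF x y) = prod_encode (4, prod_encode (x, y))"
| "code_t (TAnd \<phi> \<psi>) = prod_encode (5, prod_encode (code_t \<phi>, code_t \<psi>))"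
| "code_t (TNot \<phi>) = prod_encode (6, code_t \<phi>)"
| "code_t (TNext \<phi>) = prod_encode (7, code_t \<phi>)"
| "code_t (TUntil \<phi> \<psi>) = prod_encode (8, prod_encode (code_t \<phi>, code_t \<psi>))"

primrec code :: "lrc \<Rightarrow> nat" where
  "code (EqXi x k y) = prod_encode (0, enc3 x k y)"
| "code (EqTest x \<psi> y) = prod_encode (1, enc3 x (code \<psi>) y)"
| "code (EqTestInv x \<psi> y) = prod_encode (2, enc3 x (code \<psi>) y)"
| "code (LtXF x y) = prod_encode (3, prod_encode (x, y))"
| "code (GtXF x y) = prod_encode (4, prod_encode (x, y))"
| "code (And \<phi> \<psi>) = prod_encode (5, prod_encode (code \<phi>, code \<psi>))"
| "code (Not \<phi>) = prod_encode (6, code \<phi>)"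
| "code (Next \<phi>) = prod_encode (7, code \<phi>)"
| "code (Until \<phi> \<psi>) = prod_encode (8, prod_encode (code \<phi>, code \<psi>))"
| "code (Prev \<phi>) = prod_encode (9, code \<phi>)"
| "code (Since \<phi> \<psi>) = prod_encode (10, prod_encode (code \<phi>, code \<psi>))"

end

theory Submission
  imports Defs "HOL-Library.Countable"
begin

text \<open>A recursive function is compiled to a nondeterministic counter program, and the runs of a
  program are described by a formula of the future fragment with \<open>XF\<close> and \<open>XF\<^sup>-\<^sup>1\<close>. A counter is a
  pair of nondecreasing variables \<open>a\<close> and \<open>b\<close>: an increment moves \<open>a\<close> to a fresh larger value, a
  decrement moves \<open>b\<close>, and the counter is zero iff \<open>a = b\<close>. Requiring that every value of \<open>b\<close>
  already occurred as a value of \<open>a\<close> and that every value of \<open>a\<close> recurs as a value of \<open>b\<close> forces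
  \<open>b\<close> to retrace \<open>a\<close> value by value. Accepting runs end with all counters zero, so finitely many
  data values suffice and every infinite linear order provides them.

  The input \<open>n\<close> of the program enters through the single atom \<open>x \<approx> X\<^sup>n y\<close>, hence the code of the
  formula is a simple function of \<open>n\<close>. Taking for \<open>n\<close> the code of the formula of the program that
  runs an alleged decision procedure on the code of that formula yields a contradiction.\<close>

section \<open>Recursive functions\<close>

inductive_cases reval_ZeroE: "reval Zero xs z"
inductive_cases reval_SuccE: "reval Succ xs z"
inductive_cases reval_ProjE: "reval (Proj i) xs z"
inductive_cases reval_CompE: "reval (Comp f gs) xs z"
inductive_cases reval_Prec_0E: "reval (Prec f g) (0 # xs) z"
inductive_cases reval_Prec_SucE: "reval (Prec f g) (Suc n # xs) z"
inductive_cases reval_PrecE: "reval (Prec f g) xs z"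
inductive_cases reval_MinimE: "reval (Minim f) xs z"

lemma reval_deterministic: "reval f xs y \<Longrightarrow> reval f xs z \<Longrightarrow> y = z"
proof (induction arbitrary: z rule: reval.induct)
  case (zero xs)
  then show ?case by (auto elim!: reval_ZeroE)
next
  case (succ x xs)
  then show ?case by (auto elim!: reval_SuccE)
next
  case (proj i xs)
  then show ?case by (auto elim!: reval_ProjE)
next
  case (comp xs gs ys f v)
  from comp.prems obtain ys' where
    ys': "list_all2 (\<lambda>g y. reval g xs y) gs ys'" "reval f ys' z"
    by (auto elim!: reval_CompE)
  have "ys = ys'"
    using comp.IH(1) ys'(1)
    by (auto simp: list_all2_conv_all_nth intro!: nth_equalityI)
  then show ?case using comp.IH(2)[of z] ys'(2) by simp
next
  case (prec0 f xs v g)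
  have "reval f xs z" by (rule reval_Prec_0E[OF prec0.prems])
  then show ?case by (rule prec0.IH)
next
  case (precS f g n xs y v)
  from precS.prems obtain y' where "reval (Prec f g) (n # xs) y'" "reval g (n # y' # xs) z"
    using reval_Prec_SucE[OF precS.prems] by blast
  then show ?case using precS.IH by simp
next
  case (minim f n xs)
  from minim.prems have z: "reval f (z # xs) 0" "\<forall>m<z. \<exists>y. reval f (m # xs) y \<and> 0 < y"
    by (auto elim!: reval_MinimE)
  show ?case
  proof (rule linorder_cases[of n z])
    assume "n < z"
    then obtain y where "reval f (n # xs) y" "0 < y" using z(2) by blast
    then show ?thesis using minim.IH(1) by force
  next
    assume "z < n"
    then show ?thesis using minim.IH(2) z(1) by force
  qed auto
qed

lemma reval_CompI1: "reval g xs y \<Longrightarrow> reval f [y] z \<Longrightarrow> reval (Comp f [g]) xs z"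
  by (rule reval.comp[where ys = "[y]"]) auto

lemma reval_CompI2:
  "reval g xs y \<Longrightarrow> reval h xs y' \<Longrightarrow> reval f [y, y'] z \<Longrightarrow> reval (Comp f [g, h]) xs z"
  by (rule reval.comp[where ys = "[y, y']"]) auto

lemma reval_Comp1_iff: "reval (Comp f [g]) xs z \<longleftrightarrow> (\<exists>y. reval g xs y \<and> reval f [y] z)"
  by (auto elim!: reval_CompE simp: list_all2_Cons1 intro: reval_CompI1)

section \<open>The Cantor pairing as a recursive function\<close>

primrec rf_const :: "nat \<Rightarrow> recf" where
  "rf_const 0 = Zero"
| "rf_const (Suc c) = Comp Succ [rf_const c]"

definition rf_add :: recf where
  "rf_add = Prec (Proj 0) (Comp Succ [Proj 1])"

definition rf_triangle :: recf where
  "rf_triangle = Prec Zero (Comp Succ [Comp rf_add [Proj 0, Proj 1]])"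

definition rf_pair :: recf where
  "rf_pair = Comp rf_add [Comp rf_triangle [Comp rf_add [Proj 0, Proj 1]], Proj 0]"

lemma reval_const: "reval (rf_const c) xs c"
  by (induction c) (auto intro: reval.zero reval.succ reval_CompI1)

lemma reval_Proj0: "reval (Proj 0) (x # xs) x"
  using reval.proj[of 0 "x # xs"] by simp

lemma reval_Proj1: "reval (Proj 1) (x # y # xs) y"
  using reval.proj[of 1 "x # y # xs"] by simp

lemma reval_add: "reval rf_add [m, n] (m + n)"
proof (induction m)
  case 0
  show ?case unfolding rf_add_def by (auto intro: reval.prec0 reval_Proj0)
next
  case (Suc m)
  show ?case unfolding rf_add_def
    by (rule reval.precS[OF Suc[unfolded rf_add_def]])
      (simp, rule reval_CompI1[OF reval_Proj1[unfolded One_nat_def] reval.succ])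
qed

lemma reval_triangle: "reval rf_triangle [n] (triangle n)"
proof (induction n)
  case 0
  show ?case unfolding rf_triangle_def by (auto intro: reval.prec0 reval.zero)
next
  case (Suc n)
  have "reval (Comp Succ [Comp rf_add [Proj 0, Proj 1]]) [n, triangle n] (Suc (n + triangle n))"
    by (intro reval_CompI1[OF reval_CompI2[OF reval_Proj0 reval_Proj1 reval_add] reval.succ])
  then show ?case using reval.precS[OF Suc[unfolded rf_triangle_def]]
    unfolding rf_triangle_def by (simp add: add.commute)
qed

lemma reval_pair: "reval rf_pair [m, n] (prod_encode (m, n))"
  unfolding rf_pair_def prod_encode_def
  using reval_CompI2[OF reval_CompI1[OF reval_CompI2[OF reval_Proj0 reval_Proj1 reval_add]
        reval_triangle] reval_Proj0 reval_add] by simp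

text \<open>If \<open>n\<close> is the code of a formula, this computes the code of its conjunction
  with the atom \<open>TEqXi 0 n 1\<close>. The tags 5 for conjunction and 0 for the atom are the
  same in \<open>code\<close> and \<open>code_t\<close>, so one function serves both logics.\<close>

definition rf_diag :: recf where
  "rf_diag = Comp rf_pair [rf_const 5, Comp rf_pair [Proj 0, Comp rf_pair [rf_const 0,
     Comp rf_pair [rf_const 0, Comp rf_pair [Proj 0, rf_const 1]]]]]"

lemma reval_diag:
  "reval rf_diag [n] (prod_encode (5, prod_encode (n, prod_encode (0, enc3 0 n 1))))"
  unfolding rf_diag_def enc3_def
  by (intro reval_CompI2[OF _ _ reval_pair] reval_const reval_Proj0)

section \<open>Counter programs\<close>

text \<open>Programs are regular expressions over counter operations. A failed test or a decrement
  of zero yields no final state, so a loop with an exit condition is a star followed by a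
  test.\<close>

datatype cmd = Inc nat | Dec nat | IsZ nat | Seq cmd cmd | Star cmd

primrec exec :: "cmd \<Rightarrow> (nat \<Rightarrow> nat) \<Rightarrow> (nat \<Rightarrow> nat) set" where
  "exec (Inc r) s = {s(r := Suc (s r))}"
| "exec (Dec r) s = (if s r = 0 then {} else {s(r := s r - 1)})"
| "exec (IsZ r) s = (if s r = 0 then {s} else {})"
| "exec (Seq P Q) s = (\<Union>u\<in>exec P s. exec Q u)"
| "exec (Star P) s = {u. (\<lambda>v w. w \<in> exec P v)\<^sup>*\<^sup>* s u}"

section \<open>Transfers between registers\<close>

fun transfer :: "nat \<Rightarrow> nat list \<Rightarrow> cmd" where
  "transfer r [] = Dec r"
| "transfer r (q # qs) = Seq (Inc q) (transfer r qs)"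

definition drain :: "nat \<Rightarrow> nat list \<Rightarrow> cmd" where
  "drain r qs = Seq (Star (transfer r qs)) (IsZ r)"

lemma exec_transfer:
  "distinct qs \<Longrightarrow> r \<notin> set qs \<Longrightarrow> exec (transfer r qs) s =
    (if s r = 0 then {} else {\<lambda>x. if x = r then s r - 1 else if x \<in> set qs then s x + 1 else s x})"
  by (induction qs arbitrary: s) (auto simp: fun_eq_iff)

text \<open>The star may stop after any number \<open>m\<close> of transfers, which gives the state
  \<open>?st m\<close>; the zero test after it discards all of them except \<open>m = s r\<close>.
  The nondeterminism thus disappears.\<close>

lemma exec_drain:
  assumes "distinct qs" "r \<notin> set qs"
  shows "exec (drain r qs) s =
    {\<lambda>x. if x = r then 0 else if x \<in> set qs then s x + s r else s x}"
proof -
  let ?st = "\<lambda>m x. if x = r then s r - m else if x \<in> set qs then s x + m else s x"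
  let ?R = "\<lambda>v w. w \<in> exec (transfer r qs) v"
  have reach: "?R\<^sup>*\<^sup>* s (?st m)" if "m \<le> s r" for m
    using that
  proof (induction m)
    case 0
    have "?st 0 = s" by auto
    then show ?case by simp
  next
    case (Suc m)
    then have "?R (?st m) (?st (Suc m))"
      using assms by (auto simp: exec_transfer fun_eq_iff)
    with Suc show ?case by (meson Suc_leD rtranclp.rtrancl_into_rtrancl)
  qed
  have inv: "\<exists>m\<le>s r. u = ?st m" if "?R\<^sup>*\<^sup>* s u" for u
    using that
  proof induction
    case base
    show ?case by (rule exI[of _ 0]) auto
  next
    case (step u v)
    then obtain m where m: "m \<le> s r" "u = ?st m" by blast
    with step(2) assms have "m < s r" by (auto simp: exec_transfer split: if_splits)
    with step(2) assms m have "v = ?st (Suc m)"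
      by (auto simp: exec_transfer fun_eq_iff split: if_splits)
    with \<open>m < s r\<close> show ?case by (intro exI[of _ "Suc m"]) auto
  qed
  have "exec (drain r qs) s = {?st (s r)}"
  proof (intro equalityI subsetI)
    fix u assume "u \<in> exec (drain r qs) s"
    then have "?R\<^sup>*\<^sup>* s u" "u r = 0" by (auto simp: drain_def split: if_splits)
    then show "u \<in> {?st (s r)}" using inv[of u] by auto
  next
    fix u assume "u \<in> {?st (s r)}"
    then show "u \<in> exec (drain r qs) s" using reach[of "s r"] by (auto simp: drain_def)
  qed
  then show ?thesis by (auto simp: fun_eq_iff)
qed

definition clear :: "nat \<Rightarrow> cmd" where
  "clear r = drain r []"

definition move :: "nat \<Rightarrow> nat \<Rightarrow> cmd" where
  "move r q = drain r [q]"

text \<open>Draining destroys its source, so the content goes to the target and to a scratch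
  register \<open>t\<close> at once and is then brought back from \<open>t\<close>.\<close>

definition copy :: "nat \<Rightarrow> nat \<Rightarrow> nat \<Rightarrow> cmd" where
  "copy r q t = Seq (drain r [q, t]) (drain t [r])"

text \<open>This stands for the argument lists on which \<open>reval\<close> has no applicable
  rule.\<close>

definition fail :: cmd where
  "fail = Seq (Inc 0) (IsZ 0)"

lemma exec_clear: "exec (clear r) s = {s(r := 0)}"
  by (auto simp: clear_def exec_drain)

lemma exec_move: "r \<noteq> q \<Longrightarrow> exec (move r q) s = {s(r := 0, q := s q + s r)}"
  by (auto simp: move_def exec_drain fun_eq_iff)

lemma exec_copy:
  "distinct [r, q, t] \<Longrightarrow> s t = 0 \<Longrightarrow> exec (copy r q t) s = {s(q := s q + s r)}"
  by (auto simp: copy_def exec_drain fun_eq_iff)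

lemma exec_fail: "exec fail s = {}"
  by (simp add: fail_def)

fun clears :: "nat list \<Rightarrow> cmd \<Rightarrow> cmd" where
  "clears [] P = P"
| "clears (r # rs) P = Seq (clear r) (clears rs P)"

lemma exec_clears: "exec (clears rs P) s = exec P (\<lambda>x. if x \<in> set rs then 0 else s x)"
proof (induction rs arbitrary: s)
  case (Cons r rs)
  have "(\<lambda>x. if x \<in> set rs then 0 else (s(r := 0)) x) = (\<lambda>x. if x \<in> set (r # rs) then 0 else s x)"
    by auto
  then show ?case by (simp only: clears.simps exec.simps exec_clear Cons) simp
qed simp

section \<open>Compiling recursive functions\<close>

fun evals :: "(nat list \<Rightarrow> nat \<Rightarrow> cmd) list \<Rightarrow> nat list \<Rightarrow> nat \<Rightarrow> cmd \<Rightarrow> cmd" where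
  "evals [] xs k P = P"
| "evals (c # cs) xs k P = Seq (c xs k) (evals cs xs (Suc k) P)"

text \<open>\<open>compile f xs k\<close> reads its arguments from the registers \<open>xs\<close>, all below \<open>k\<close>, expects the
  registers from \<open>k\<close> on to be zero, and leaves the value in register \<open>k\<close> as its only effect.\<close>

primrec compile :: "recf \<Rightarrow> nat list \<Rightarrow> nat \<Rightarrow> cmd" where
  "compile Zero = (\<lambda>xs k. IsZ k)"
| "compile Succ = (\<lambda>xs k. case xs of [] \<Rightarrow> fail | x # _ \<Rightarrow> Seq (copy x k (k + 1)) (Inc k))"
| "compile (Proj i) = (\<lambda>xs k. if i < length xs then copy (xs ! i) k (k + 1) else fail)"
| "compile (Comp f gs) = (\<lambda>xs k.
     let rs = [k + 1..<k + 1 + length gs]; t = k + 1 + length gs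
     in evals (map compile gs) xs (k + 1) (Seq (compile f rs t) (clears rs (move t k))))"
| "compile (Prec f g) = (\<lambda>xs k. case xs of [] \<Rightarrow> fail | n # xs \<Rightarrow>
     Seq (compile f xs k)
    (Seq (copy n (k + 2) (k + 3))
    (Seq (Star (Seq (Dec (k + 2))
               (Seq (compile g ((k + 1) # k # xs) (k + 3))
               (Seq (clear k) (Seq (move (k + 3) k) (Inc (k + 1)))))))
    (Seq (IsZ (k + 2)) (clear (k + 1))))))"
| "compile (Minim f) = (\<lambda>xs k.
     Seq (Star (Seq (compile f (k # xs) (k + 1))
               (Seq (Dec (k + 1)) (Seq (clear (k + 1)) (Inc k)))))
    (Seq (compile f (k # xs) (k + 1)) (IsZ (k + 1))))"

text \<open>An equality of sets expresses soundness and completeness together, and an undefined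
  value becomes the absence of terminating runs. The update at \<open>k\<close> alone says that
  arguments survive and scratch registers return to zero.\<close>

definition implements :: "(nat list \<Rightarrow> nat \<Rightarrow> cmd) \<Rightarrow> recf \<Rightarrow> bool" where
  "implements c f \<longleftrightarrow> (\<forall>xs k s. (\<forall>x\<in>set xs. x < k) \<longrightarrow> (\<forall>r\<ge>k. s r = 0) \<longrightarrow>
     exec (c xs k) s = {s(k := z) | z. reval f (map s xs) z})"

lemma UN_singleton_eq: "(\<Union>x\<in>{a}. F x) = F a"
  by simp

lemma UN_Collect_eq: "(\<Union>x\<in>{f z | z. Q z}. F x) = (\<Union>z\<in>{z. Q z}. F (f z))"
  by auto

lemma UN_Collect_singleton: "(\<Union>z\<in>{z. Q z}. {f z}) = {f z | z. Q z}"
  by auto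

lemma implementsD:
  "implements c f \<Longrightarrow> (\<And>x. x \<in> set xs \<Longrightarrow> x < k) \<Longrightarrow> (\<And>r. r \<ge> k \<Longrightarrow> s r = 0) \<Longrightarrow>
    exec (c xs k) s = {s(k := z) | z. reval f (map s xs) z}"
  unfolding implements_def by blast

lemma map_fun_upd_notin: "x \<notin> set xs \<Longrightarrow> map (f(x := y)) xs = map f xs"
  by simp

definition store_list :: "nat \<Rightarrow> nat list \<Rightarrow> (nat \<Rightarrow> nat) \<Rightarrow> nat \<Rightarrow> nat" where
  "store_list k ys s = (\<lambda>r. if k \<le> r \<and> r < k + length ys then ys ! (r - k) else s r)"

lemma store_list_Nil: "store_list k [] s = s"
  by (auto simp: store_list_def)

lemma store_list_Cons: "store_list k (y # ys) s = store_list (Suc k) ys (s(k := y))"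
proof
  fix r show "store_list k (y # ys) s r = store_list (Suc k) ys (s(k := y)) r"
    by (cases "r \<le> k") (auto simp: store_list_def nth_Cons' less_Suc_eq_le)
qed

text \<open>The arguments lie below \<open>k\<close>, so storing one result at \<open>k\<close>
  leaves them intact for the remaining functions. The induction shifts \<open>k\<close> by one per
  result.\<close>

lemma exec_evals:
  assumes "\<And>g. g \<in> set gs \<Longrightarrow> implements (compile g) g"
    and "\<And>x. x \<in> set xs \<Longrightarrow> x < k" "\<And>r. r \<ge> k \<Longrightarrow> s r = 0"
  shows "exec (evals (map compile gs) xs k P) s =
    (\<Union>ys\<in>{ys. list_all2 (\<lambda>g y. reval g (map s xs) y) gs ys}. exec P (store_list k ys s))"
  using assms
proof (induction gs arbitrary: k s)
  case Nil
  then show ?case by (simp add: store_list_Nil)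
next
  case (Cons g gs)
  have "implements (compile g) g" using Cons.prems(1) by simp
  then have g: "exec (compile g xs k) s = {s(k := z) | z. reval g (map s xs) z}"
    using Cons.prems(2,3) by (rule implementsD)
  have k: "k \<notin> set xs" using Cons.prems(2) by blast
  have IH: "exec (evals (map compile gs) xs (Suc k) P) (s(k := z)) =
    (\<Union>ys\<in>{ys. list_all2 (\<lambda>g y. reval g (map s xs) y) gs ys}. exec P (store_list (Suc k) ys (s(k := z))))"
    for z
  proof -
    have "exec (evals (map compile gs) xs (Suc k) P) (s(k := z)) =
      (\<Union>ys\<in>{ys. list_all2 (\<lambda>g y. reval g (map (s(k := z)) xs) y) gs ys}.
        exec P (store_list (Suc k) ys (s(k := z))))"
      by (rule Cons.IH) (use Cons.prems in \<open>auto simp: less_SucI\<close>)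
    then show ?thesis unfolding map_fun_upd_notin[OF k] .
  qed
  have "exec (evals (map compile (g # gs)) xs k P) s =
      (\<Union>z\<in>{z. reval g (map s xs) z}. exec (evals (map compile gs) xs (Suc k) P) (s(k := z)))"
    using g by auto
  also have "\<dots> = (\<Union>z\<in>{z. reval g (map s xs) z}.
      \<Union>ys\<in>{ys. list_all2 (\<lambda>g y. reval g (map s xs) y) gs ys}. exec P (store_list k (z # ys) s))"
    unfolding IH store_list_Cons ..
  also have "\<dots> = (\<Union>ys\<in>{ys. list_all2 (\<lambda>g y. reval g (map s xs) y) (g # gs) ys}.
      exec P (store_list k ys s))"
    unfolding list_all2_Cons1 by blast
  finally show ?case .
qed

lemma implements_Comp:
  assumes gs: "\<And>g. g \<in> set gs \<Longrightarrow> implements (compile g) g" and f: "implements (compile f) f"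
  shows "implements (compile (Comp f gs)) (Comp f gs)"
  unfolding implements_def
proof (intro allI impI)
  fix xs k and s :: "nat \<Rightarrow> nat"
  assume xs: "\<forall>x\<in>set xs. x < k" and s: "\<forall>r\<ge>k. s r = 0"
  define rs where "rs = [k + 1..<k + 1 + length gs]"
  define t where "t = k + 1 + length gs"
  \<comment> \<open>The results occupy \<open>rs\<close>, and \<open>t\<close> is the first register
    above them. There \<open>f\<close> finds only zeros, as its specification requires; clearing
    \<open>rs\<close> and moving \<open>t\<close> to \<open>k\<close> restores everything
    else.\<close>
  have tail: "exec (Seq (compile f rs t) (clears rs (move t k))) (store_list (k + 1) ys s) =
      {s(k := z) | z. reval f ys z}"
    if len: "length ys = length gs" for ys
  proof -
    have m: "map (store_list (k + 1) ys s) rs = ys"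
      using len by (intro nth_equalityI) (auto simp: store_list_def rs_def simp del: upt_Suc)
    have "exec (compile f rs t) (store_list (k + 1) ys s) =
        {(store_list (k + 1) ys s)(t := z) | z. reval f ys z}"
      using implementsD[OF f, of rs t "store_list (k + 1) ys s", unfolded m] s len
      by (simp add: rs_def t_def store_list_def less_Suc_eq_le del: upt_Suc)
    moreover have "exec (clears rs (move t k)) ((store_list (k + 1) ys s)(t := z)) = {s(k := z)}" for z
      using s len
      by (auto simp: exec_clears exec_move t_def fun_eq_iff rs_def store_list_def Suc_le_eq)
    ultimately show ?thesis by auto
  qed
  have "exec (compile (Comp f gs) xs k) s =
      (\<Union>ys\<in>{ys. list_all2 (\<lambda>g y. reval g (map s xs) y) gs ys}.
        exec (Seq (compile f rs t) (clears rs (move t k))) (store_list (k + 1) ys s))"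
    unfolding compile.simps Let_def t_def[symmetric] rs_def[folded t_def, symmetric]
    using xs s by (intro exec_evals gs) auto
  also have "\<dots> = (\<Union>ys\<in>{ys. list_all2 (\<lambda>g y. reval g (map s xs) y) gs ys}. {s(k := z) | z. reval f ys z})"
    by (intro SUP_cong refl tail) (simp add: list_all2_lengthD)
  also have "\<dots> = {s(k := z) | z. reval (Comp f gs) (map s xs) z}"
    by (auto elim!: reval_CompE intro: reval.comp)
  finally show "exec (compile (Comp f gs) xs k) s = {s(k := z) | z. reval (Comp f gs) (map s xs) z}" .
qed

lemma implements_Prec:
  assumes f: "implements (compile f) f" and g: "implements (compile g) g"
  shows "implements (compile (Prec f g)) (Prec f g)"
  unfolding implements_def
proof (intro allI impI)
  fix ns k and s :: "nat \<Rightarrow> nat"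
  assume ns: "\<forall>x\<in>set ns. x < k" and s: "\<forall>r\<ge>k. s r = 0"
  show "exec (compile (Prec f g) ns k) s = {s(k := z) | z. reval (Prec f g) (map s ns) z}"
  proof (cases ns)
    case Nil
    then show ?thesis by (auto simp: exec_fail elim!: reval_PrecE)
  next
    case (Cons n xs)
    define v where "v = map s xs"
    \<comment> \<open>The state after \<open>i\<close> rounds of the loop: \<open>k\<close> holds
      the value of the recursion at \<open>i\<close>, \<open>k + 1\<close> the index, and
      \<open>k + 2\<close> the number of rounds left.\<close>
    define st where "st i y = s(k := y, k + 1 := i, k + 2 := s n - i)" for i y
    define body where "body = Seq (Dec (k + 2)) (Seq (compile g ((k + 1) # k # xs) (k + 3))
               (Seq (clear k) (Seq (move (k + 3) k) (Inc (k + 1)))))"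
    let ?R = "\<lambda>v w. w \<in> exec body v"
    have n: "n < k" and xs: "\<And>x. x \<in> set xs \<Longrightarrow> x < k" using ns Cons by auto
    have map_xs: "map u xs = v" if "\<And>x. x < k \<Longrightarrow> u x = s x" for u
      using that xs by (auto simp: v_def)
    have body: "exec body (st i y) = (if i < s n then {st (Suc i) z | z. reval g (i # y # v) z} else {})"
      for i y
    proof (cases "i < s n")
      case True
      define u where "u = (st i y)(k + 2 := s n - i - 1)"
      have call: "exec (compile g ((k + 1) # k # xs) (k + 3)) u =
          {u(k + 3 := z) | z. reval g (map u ((k + 1) # k # xs)) z}"
        using s xs by (intro implementsD[OF g]) (auto simp: u_def st_def less_SucI dest!: xs)
      have args: "map u ((k + 1) # k # xs) = i # y # v"
        using map_xs[of u] by (auto simp: u_def st_def)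
      have tail: "exec (Seq (clear k) (Seq (move (k + 3) k) (Inc (k + 1)))) (u(k + 3 := z)) =
          {st (Suc i) z}" for z
        using s by (auto simp: exec_clear exec_move u_def st_def fun_eq_iff)
      have dec: "exec (Dec (k + 2)) (st i y) = {u}"
        using True by (auto simp: u_def st_def)
      have "exec body (st i y) = (\<Union>w\<in>exec (compile g ((k + 1) # k # xs) (k + 3)) u.
          exec (Seq (clear k) (Seq (move (k + 3) k) (Inc (k + 1)))) w)"
        unfolding body_def exec.simps(4)[of "Dec _"] exec.simps(4)[of "compile _ _ _"] dec
        by (rule UN_singleton_eq)
      also have "\<dots> = (\<Union>z\<in>{z. reval g (i # y # v) z}. {st (Suc i) z})"
        unfolding call args UN_Collect_eq tail ..
      also have "\<dots> = {st (Suc i) z | z. reval g (i # y # v) z}"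
        by (rule UN_Collect_singleton)
      finally show ?thesis using True by simp
    qed (auto simp: body_def st_def)
    have inv: "\<exists>i\<le>s n. \<exists>y. u = st i y \<and> reval (Prec f g) (i # v) y"
      if "?R\<^sup>*\<^sup>* (st 0 y0) u" "reval f v y0" for u y0
      using that
    proof induction
      case base
      then show ?case by (intro exI[of _ 0]) (auto intro: reval.prec0)
    next
      case (step u w)
      then show ?case by (auto simp: body split: if_splits) (metis Suc_leI reval.precS)
    qed
    have reach: "\<exists>y0. reval f v y0 \<and> ?R\<^sup>*\<^sup>* (st 0 y0) (st i y)"
      if "reval (Prec f g) (i # v) y" "i \<le> s n" for i y
      using that
    proof (induction i arbitrary: y)
      case 0
      then show ?case by (auto elim!: reval_Prec_0E)
    next
      case (Suc i)
      from Suc.prems(1) obtain y' where y': "reval (Prec f g) (i # v) y'" "reval g (i # y' # v) y"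
        by (auto elim!: reval_Prec_SucE)
      moreover have "?R (st i y') (st (Suc i) y)" using y'(2) Suc.prems(2) by (auto simp: body)
      ultimately show ?case using Suc by (meson Suc_leD rtranclp.rtrancl_into_rtrancl)
    qed
    have pre: "exec (compile f xs k) s = {s(k := y0) | y0. reval f v y0}"
      unfolding v_def using s xs by (intro implementsD[OF f]) auto
    have cp: "exec (copy n (k + 2) (k + 3)) (s(k := y0)) = {st 0 y0}" for y0
      using s n by (subst exec_copy) (auto simp: st_def fun_eq_iff)
    \<comment> \<open>The difference \<open>s n - i\<close> is truncated, so the test only gives
      \<open>s n \<le> i\<close>; the bound \<open>i \<le> s n\<close> from \<open>inv\<close> turns
      this into equality.\<close>
    have fin: "exec (Seq (IsZ (k + 2)) (clear (k + 1))) (st i y) = (if s n \<le> i then {s(k := y)} else {})"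
      for i y
      using s by (auto simp: exec_clear st_def fun_eq_iff)
    have "exec (compile (Prec f g) ns k) s =
        (\<Union>y0\<in>{y0. reval f v y0}. \<Union>u\<in>{u. ?R\<^sup>*\<^sup>* (st 0 y0) u}. exec (Seq (IsZ (k + 2)) (clear (k + 1))) u)"
      unfolding Cons compile.simps list.case body_def[symmetric]
        exec.simps(4)[of "compile f xs k"] pre UN_Collect_eq
        exec.simps(4)[of "copy _ _ _"] cp UN_singleton_eq
        exec.simps(4)[of "Star body"] exec.simps(5) ..
    also have "\<dots> = {s(k := z) | z. reval (Prec f g) (s n # v) z}" (is "?L = ?Rt")
    proof (intro equalityI subsetI)
      fix w assume "w \<in> ?L"
      then obtain y0 u where y0: "reval f v y0" "?R\<^sup>*\<^sup>* (st 0 y0) u"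
        and w: "w \<in> exec (Seq (IsZ (k + 2)) (clear (k + 1))) u" by auto
      obtain i y where iy: "i \<le> s n" "u = st i y" "reval (Prec f g) (i # v) y"
        using inv[OF y0(2,1)] by blast
      then have "i = s n" "w = s(k := y)" using w unfolding iy fin by (auto split: if_splits)
      then show "w \<in> ?Rt" using iy by blast
    next
      fix w assume "w \<in> ?Rt"
      then obtain z where z: "w = s(k := z)" "reval (Prec f g) (s n # v) z" by blast
      obtain y0 where y0: "reval f v y0" "?R\<^sup>*\<^sup>* (st 0 y0) (st (s n) z)"
        using reach[OF z(2)] by blast
      have "w \<in> exec (Seq (IsZ (k + 2)) (clear (k + 1))) (st (s n) z)" unfolding fin z by simp
      with y0 show "w \<in> ?L" by blast
    qed
    finally show ?thesis using Cons by (simp add: v_def)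
  qed
qed

lemma implements_Minim:
  assumes f: "implements (compile f) f"
  shows "implements (compile (Minim f)) (Minim f)"
  unfolding implements_def
proof (intro allI impI)
  fix xs k and s :: "nat \<Rightarrow> nat"
  assume xs: "\<forall>x\<in>set xs. x < k" and s: "\<forall>r\<ge>k. s r = 0"
  define v where "v = map s xs"
  define body where "body = Seq (compile f (k # xs) (k + 1))
    (Seq (Dec (k + 1)) (Seq (clear (k + 1)) (Inc k)))"
  let ?R = "\<lambda>v w. w \<in> exec body v"
  have call: "exec (compile f (k # xs) (k + 1)) (s(k := n)) =
      {s(k := n, k + 1 := z) | z. reval f (n # v) z}" for n
  proof -
    have args: "map (s(k := n)) (k # xs) = n # v" using xs by (auto simp: v_def)
    have "exec (compile f (k # xs) (k + 1)) (s(k := n)) =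
        {s(k := n, k + 1 := z) | z. reval f (map (s(k := n)) (k # xs)) z}"
      by (rule implementsD[OF f]) (use xs s in \<open>auto simp: less_SucI\<close>)
    then show ?thesis unfolding args .
  qed
  \<comment> \<open>The decrement acts as a test for a positive value; what remains of the value is
    thrown away.\<close>
  have tail: "exec (Seq (Dec (k + 1)) (Seq (clear (k + 1)) (Inc k))) (s(k := n, k + 1 := z)) =
      (if 0 < z then {s(k := Suc n)} else {})" for n z
  proof -
    define u where "u = s(k := n, k + 1 := z)"
    have "u(k + 1 := z', k + 1 := 0, k := Suc n) = s(k := Suc n)" for z'
      by (rule ext) (simp add: u_def s)
    moreover have "u (k + 1) = z" by (simp add: u_def)
    moreover have "u k = n" by (simp add: u_def)
    ultimately show ?thesis unfolding u_def[symmetric] by (simp add: exec_clear)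
  qed
  have body: "exec body (s(k := n)) =
      (if \<exists>z. reval f (n # v) z \<and> 0 < z then {s(k := Suc n)} else {})" for n
  proof -
    have "exec body (s(k := n)) = (\<Union>z\<in>{z. reval f (n # v) z}.
        exec (Seq (Dec (k + 1)) (Seq (clear (k + 1)) (Inc k))) (s(k := n, k + 1 := z)))"
      unfolding body_def exec.simps(4)[of "compile f (k # xs) (k + 1)"] call UN_Collect_eq ..
    then show ?thesis unfolding tail by auto
  qed
  \<comment> \<open>The loop may be left at any candidate, but it has passed only candidates with a
    positive value. The zero test after the loop therefore accepts exactly the minimum.\<close>
  have inv: "\<exists>n. u = s(k := n) \<and> (\<forall>m<n. \<exists>y. reval f (m # v) y \<and> 0 < y)"
    if "?R\<^sup>*\<^sup>* s u" for u
    using that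
  proof induction
    case base
    show ?case using s by (intro exI[of _ 0]) auto
  next
    case (step u w)
    then obtain n where "u = s(k := n)" "\<forall>m<n. \<exists>y. reval f (m # v) y \<and> 0 < y" by blast
    then show ?case using step(2)
      by (intro exI[of _ "Suc n"]) (auto simp: body less_Suc_eq split: if_splits)
  qed
  have reach: "?R\<^sup>*\<^sup>* s (s(k := n))" if "\<forall>m<n. \<exists>y. reval f (m # v) y \<and> 0 < y" for n
    using that
  proof (induction n)
    case 0
    have "s(k := 0) = s" using s by auto
    then show ?case by simp
  next
    case (Suc n)
    then have "?R (s(k := n)) (s(k := Suc n))" by (auto simp: body)
    with Suc show ?case by (meson less_SucI rtranclp.rtrancl_into_rtrancl)
  qed
  have fin: "exec (Seq (compile f (k # xs) (k + 1)) (IsZ (k + 1))) (s(k := n)) =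
      (if reval f (n # v) 0 then {s(k := n)} else {})" for n
  proof -
    have z: "exec (IsZ (k + 1)) (s(k := n, k + 1 := z)) = (if z = 0 then {s(k := n)} else {})" for z
      using s by (auto simp: fun_eq_iff)
    have "exec (Seq (compile f (k # xs) (k + 1)) (IsZ (k + 1))) (s(k := n)) =
        (\<Union>z\<in>{z. reval f (n # v) z}. exec (IsZ (k + 1)) (s(k := n, k + 1 := z)))"
      unfolding exec.simps(4) call UN_Collect_eq ..
    then show ?thesis unfolding z by auto
  qed
  have "exec (compile (Minim f) xs k) s =
      (\<Union>u\<in>{u. ?R\<^sup>*\<^sup>* s u}. exec (Seq (compile f (k # xs) (k + 1)) (IsZ (k + 1))) u)"
    unfolding compile.simps body_def[symmetric] exec.simps(4)[of "Star body"] exec.simps(5) ..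
  also have "\<dots> = {s(k := n) | n. reval (Minim f) v n}" (is "?L = ?Rt")
  proof (intro equalityI subsetI)
    fix w assume "w \<in> ?L"
    then obtain u where u: "?R\<^sup>*\<^sup>* s u"
      and w: "w \<in> exec (Seq (compile f (k # xs) (k + 1)) (IsZ (k + 1))) u" by auto
    obtain n where n: "u = s(k := n)" "\<forall>m<n. \<exists>y. reval f (m # v) y \<and> 0 < y"
      using inv[OF u] by blast
    then have "reval f (n # v) 0" "w = s(k := n)" using w unfolding n fin by (auto split: if_splits)
    then show "w \<in> ?Rt" using n reval.minim by blast
  next
    fix w assume "w \<in> ?Rt"
    then obtain n where n: "w = s(k := n)" "reval f (n # v) 0"
      "\<forall>m<n. \<exists>y. reval f (m # v) y \<and> 0 < y" by (auto elim!: reval_MinimE)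
    have "w \<in> exec (Seq (compile f (k # xs) (k + 1)) (IsZ (k + 1))) (s(k := n))"
      unfolding fin n using n(2) by simp
    then show "w \<in> ?L" using reach[OF n(3)] by blast
  qed
  finally show "exec (compile (Minim f) xs k) s = {s(k := z) | z. reval (Minim f) (map s xs) z}"
    by (simp add: v_def)
qed

theorem implements_compile: "implements (compile f) f"
proof (induction f)
  case Zero
  show ?case unfolding implements_def
  proof (intro allI impI)
    fix xs k and s :: "nat \<Rightarrow> nat"
    assume s: "\<forall>r\<ge>k. s r = 0"
    have "{s(k := z) | z. reval Zero (map s xs) z} = {s(k := 0)}"
      by (auto intro: reval.zero elim!: reval_ZeroE)
    then show "exec (compile Zero xs k) s = {s(k := z) | z. reval Zero (map s xs) z}"
      using s by (simp add: fun_upd_idem)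
  qed
next
  case Succ
  show ?case unfolding implements_def
  proof (intro allI impI)
    fix xs k and s :: "nat \<Rightarrow> nat"
    assume xs: "\<forall>x\<in>set xs. x < k" and s: "\<forall>r\<ge>k. s r = 0"
    show "exec (compile Succ xs k) s = {s(k := z) | z. reval Succ (map s xs) z}"
    proof (cases xs)
      case (Cons x ys)
      have "{s(k := z) | z. reval Succ (map s xs) z} = {s(k := Suc (s x))}"
        unfolding Cons list.map by (auto intro: reval.succ elim!: reval_SuccE)
      then show ?thesis using xs s Cons by (simp add: exec_copy)
    qed (auto simp: exec_fail elim!: reval_SuccE)
  qed
next
  case (Proj i)
  show ?case
    unfolding implements_def
  proof (intro allI impI)
    fix xs k and s :: "nat \<Rightarrow> nat"
    assume xs: "\<forall>x\<in>set xs. x < k" and s: "\<forall>r\<ge>k. s r = 0"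
    show "exec (compile (Proj i) xs k) s = {s(k := z) | z. reval (Proj i) (map s xs) z}"
    proof (cases "i < length xs")
      case True
      then have "xs ! i < k" using xs by simp
      then have "exec (compile (Proj i) xs k) s = {s(k := s (xs ! i))}"
        using True s by (simp add: exec_copy)
      moreover have "reval (Proj i) (map s xs) z \<longleftrightarrow> z = s (xs ! i)" for z
        using True reval.proj[of i "map s xs"] reval_ProjE[of i "map s xs" z] by auto
      ultimately show ?thesis by simp
    qed (auto simp: exec_fail elim!: reval_ProjE)
  qed
qed (simp_all only: implements_Comp implements_Prec implements_Minim)

section \<open>Small steps on continuations\<close>

text \<open>A control state is the list of commands still to be run. The only choice is at a star,
  which is either left or unfolded once.\<close>

primrec succs :: "cmd \<Rightarrow> cmd list \<Rightarrow> cmd list list" where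
  "succs (Inc r) K = [K]"
| "succs (Dec r) K = [K]"
| "succs (IsZ r) K = [K]"
| "succs (Seq P Q) K = [P # Q # K]"
| "succs (Star P) K = [K, P # Star P # K]"

definition effect :: "cmd \<Rightarrow> (nat \<Rightarrow> nat) \<Rightarrow> (nat \<Rightarrow> nat) \<Rightarrow> bool" where
  "effect c s s' \<longleftrightarrow> (\<forall>r. if c = Inc r then s' r = Suc (s r)
     else if c = Dec r then s r = Suc (s' r) else s' r = s r) \<and> (\<forall>r. c = IsZ r \<longrightarrow> s r = 0)"

inductive step :: "cmd list \<times> (nat \<Rightarrow> nat) \<Rightarrow> cmd list \<times> (nat \<Rightarrow> nat) \<Rightarrow> bool" where
  "K' \<in> set (succs c K) \<Longrightarrow> effect c s s' \<Longrightarrow> step (c # K, s) (K', s')"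

primrec execs :: "cmd list \<Rightarrow> (nat \<Rightarrow> nat) \<Rightarrow> (nat \<Rightarrow> nat) set" where
  "execs [] s = {s}"
| "execs (P # K) s = (\<Union>u\<in>exec P s. execs K u)"

lemma effect_Inc: "effect (Inc r) s s' \<longleftrightarrow> s' = s(r := Suc (s r))"
  by (auto simp: effect_def fun_eq_iff)

lemma effect_Dec: "effect (Dec r) s s' \<longleftrightarrow> 0 < s r \<and> s' = s(r := s r - 1)"
proof
  assume e: "effect (Dec r) s s'"
  then have "s r = Suc (s' r)" by (auto simp: effect_def)
  then show "0 < s r \<and> s' = s(r := s r - 1)" using e by (auto simp: effect_def fun_eq_iff)
next
  assume "0 < s r \<and> s' = s(r := s r - 1)"
  then show "effect (Dec r) s s'" by (auto simp: effect_def)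
qed

lemma effect_IsZ: "effect (IsZ r) s s' \<longleftrightarrow> s r = 0 \<and> s' = s"
  by (auto simp: effect_def)

lemma effect_Seq: "effect (Seq P Q) s s' \<longleftrightarrow> s' = s"
  by (auto simp: effect_def)

lemma effect_Star: "effect (Star P) s s' \<longleftrightarrow> s' = s"
  by (auto simp: effect_def)

lemmas effect_simps = effect_Inc effect_Dec effect_IsZ effect_Seq effect_Star

text \<open>Going backwards along a step can only enlarge the set of possible outcomes. As
  \<open>execs []\<close> contains just the current state, a completed run ends in an outcome of its
  start.\<close>

lemma execs_step:
  assumes "step (K, s) (K', s')"
  shows "execs K' s' \<subseteq> execs K s"
  using assms
proof cases
  case (1 c L)
  have star: "(\<lambda>v w. w \<in> exec P v)\<^sup>*\<^sup>* s u" if "v \<in> exec P s" "(\<lambda>v w. w \<in> exec P v)\<^sup>*\<^sup>* v u" for P u v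
    using that by (rule converse_rtranclp_into_rtranclp)
  then show ?thesis using 1 by (cases c) (auto simp: effect_simps, use star in blast)
qed

lemma execs_steps: "step\<^sup>*\<^sup>* (K, s) ([], s') \<Longrightarrow> s' \<in> execs K s"
  by (induction "(K, s)" arbitrary: K s rule: converse_rtranclp_induct)
    (auto dest: execs_step)

lemma step_single: "K' \<in> set (succs c K) \<Longrightarrow> effect c s s' \<Longrightarrow> step\<^sup>*\<^sup>* (c # K, s) (K', s')"
  by (blast intro: step.intros)

lemma exec_steps: "s' \<in> exec P s \<Longrightarrow> step\<^sup>*\<^sup>* (P # K, s) (K, s')"
proof (induction P arbitrary: s s' K)
  case (Seq P Q)
  then obtain u where u: "u \<in> exec P s" "s' \<in> exec Q u" by auto
  have "step\<^sup>*\<^sup>* (Seq P Q # K, s) (P # Q # K, s)"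
    by (rule step_single) (auto simp: effect_simps)
  also have "step\<^sup>*\<^sup>* \<dots> (Q # K, u)" by (rule Seq.IH(1)[OF u(1)])
  also have "step\<^sup>*\<^sup>* \<dots> (K, s')" by (rule Seq.IH(2)[OF u(2)])
  finally show ?case .
next
  case (Star P)
  then have "(\<lambda>v w. w \<in> exec P v)\<^sup>*\<^sup>* s s'" by simp
  then show ?case
  proof (induction rule: converse_rtranclp_induct)
    case base
    show ?case by (rule step_single) (auto simp: effect_simps)
  next
    case (step u v)
    have "step\<^sup>*\<^sup>* (Star P # K, u) (P # Star P # K, u)"
      by (rule step_single) (auto simp: effect_simps)
    also have "step\<^sup>*\<^sup>* \<dots> (Star P # K, v)" by (rule Star.IH[OF step(1)])
    also have "step\<^sup>*\<^sup>* \<dots> (K, s')" by (rule step.IH)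
    finally show ?case .
  qed
qed (auto intro!: step_single simp: effect_simps split: if_splits)

text \<open>The finite control of \<open>P\<close>: a list containing all continuations that occur
  while \<open>P\<close> runs in front of \<open>K\<close>. The exit \<open>K\<close> is not listed.
  Finiteness lets a single formula describe all transitions.\<close>

primrec conts :: "cmd \<Rightarrow> cmd list \<Rightarrow> cmd list list" where
  "conts (Inc r) K = [Inc r # K]"
| "conts (Dec r) K = [Dec r # K]"
| "conts (IsZ r) K = [IsZ r # K]"
| "conts (Seq P Q) K = (Seq P Q # K) # conts P (Q # K) @ conts Q K"
| "conts (Star P) K = (Star P # K) # conts P (Star P # K)"

primrec reg_bound :: "cmd \<Rightarrow> nat" where
  "reg_bound (Inc r) = Suc r"
| "reg_bound (Dec r) = Suc r"
| "reg_bound (IsZ r) = Suc r"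
| "reg_bound (Seq P Q) = max (reg_bound P) (reg_bound Q)"
| "reg_bound (Star P) = reg_bound P"

lemma conts_start: "P # K \<in> set (conts P K)"
  by (cases P) auto

lemma conts_nonempty: "L \<in> set (conts P K) \<Longrightarrow> L \<noteq> []"
  by (induction P arbitrary: K) auto

lemma conts_reg_bound:
  "L \<in> set (conts P K) \<Longrightarrow> reg_bound P \<le> R \<Longrightarrow> \<forall>c\<in>set K. reg_bound c \<le> R \<Longrightarrow>
    \<forall>c\<in>set L. reg_bound c \<le> R"
proof (induction P arbitrary: K)
  case (Seq P Q)
  have "L = Seq P Q # K \<or> L \<in> set (conts P (Q # K)) \<or> L \<in> set (conts Q K)"
    using Seq.prems(1) by auto
  then show ?case using Seq.IH(1)[of "Q # K"] Seq.IH(2)[of K] Seq.prems(2,3) by auto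
next
  case (Star P)
  have "L = Star P # K \<or> L \<in> set (conts P (Star P # K))" using Star.prems(1) by auto
  then show ?case using Star.IH[of "Star P # K"] Star.prems(2,3) by auto
qed auto

lemma conts_closed:
  "c # L \<in> set (conts P K) \<Longrightarrow> L' \<in> set (succs c L) \<Longrightarrow> L' = K \<or> L' \<in> set (conts P K)"
proof (induction P arbitrary: K)
  case (Seq P Q)
  consider "c = Seq P Q" "L = K" | "c # L \<in> set (conts P (Q # K))" | "c # L \<in> set (conts Q K)"
    using Seq.prems(1) by auto
  then show ?case
  proof cases
    case 1
    then show ?thesis using Seq.prems(2) conts_start[of P "Q # K"] by auto
  next
    case 2
    then show ?thesis using Seq.IH(1)[OF 2 Seq.prems(2)] conts_start[of Q K] by auto
  next
    case 3
    then show ?thesis using Seq.IH(2)[OF 3 Seq.prems(2)] by auto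
  qed
next
  case (Star P)
  consider "c = Star P" "L = K" | "c # L \<in> set (conts P (Star P # K))"
    using Star.prems(1) by auto
  then show ?case
  proof cases
    case 1
    then show ?thesis using Star.prems(2) conts_start[of P "Star P # K"] by auto
  next
    case 2
    then show ?thesis using Star.IH[OF 2 Star.prems(2)] by auto
  qed
qed auto

section \<open>Counters in a linear order\<close>

text \<open>Increments advance \<open>a\<close>, decrements advance \<open>b\<close>. As \<open>b\<close> is monotone and visits all values of
  \<open>a\<close> and no others, it cannot skip any of them, so the counter is the number of steps by which
  \<open>b\<close> lags behind \<open>a\<close>.\<close>

definition paired :: "(nat \<Rightarrow> 'd::linorder) \<Rightarrow> (nat \<Rightarrow> 'd) \<Rightarrow> bool" where
  "paired a b \<longleftrightarrow> mono a \<and> mono b \<and> (\<forall>i. \<exists>j\<le>i. b i = a j) \<and> (\<forall>i. \<exists>j\<ge>i. a i = b j) \<and>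
     (\<forall>i. a (Suc i) = a i \<or> b (Suc i) = b i)"

text \<open>The link is by equivalences, so that it can be used both to read a run off a model and
  to verify the formula in a model built from a run.\<close>

definition counts :: "(nat \<Rightarrow> 'd) \<Rightarrow> (nat \<Rightarrow> 'd) \<Rightarrow> (nat \<Rightarrow> nat) \<Rightarrow> bool" where
  "counts a b c \<longleftrightarrow> (\<forall>i.
     (a (Suc i) \<noteq> a i \<and> b (Suc i) = b i \<longleftrightarrow> c (Suc i) = Suc (c i)) \<and>
     (a (Suc i) = a i \<and> b (Suc i) \<noteq> b i \<longleftrightarrow> c i = Suc (c (Suc i))) \<and>
     (a (Suc i) = a i \<and> b (Suc i) = b i \<longleftrightarrow> c (Suc i) = c i) \<and>
     (a i = b i \<longleftrightarrow> c i = 0))"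

lemma nat_intermediate_value:
  fixes f :: "nat \<Rightarrow> nat"
  assumes "\<And>i. f (Suc i) \<le> Suc (f i)" "m \<le> n" "f m \<le> v" "v \<le> f n"
  shows "\<exists>j. m \<le> j \<and> j \<le> n \<and> f j = v"
  using assms(2,4)
proof (induction n rule: dec_induct)
  case base
  then show ?case using assms(3) by auto
next
  case (step n)
  show ?case
  proof (cases "v \<le> f n")
    case True
    then show ?thesis using step by (meson le_Suc_eq)
  next
    case False
    then have "f (Suc n) = v" using step.prems assms(1)[of n] by linarith
    then show ?thesis using step.hyps(1) by (intro exI[of _ "Suc n"]) simp
  qed
qed

section \<open>Ranks of the values of a monotone sequence\<close>

definition changes :: "(nat \<Rightarrow> 'd) \<Rightarrow> nat \<Rightarrow> nat" where
  "changes a i = card {j. j < i \<and> a (Suc j) \<noteq> a j}"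

lemma changes_0: "changes a 0 = 0"
  by (simp add: changes_def)

lemma changes_Suc: "changes a (Suc i) = (if a (Suc i) = a i then changes a i else Suc (changes a i))"
proof -
  have "{j. j < Suc i \<and> a (Suc j) \<noteq> a j} =
      (if a (Suc i) = a i then {} else {i}) \<union> {j. j < i \<and> a (Suc j) \<noteq> a j}"
    by (auto simp: less_Suc_eq)
  then show ?thesis by (simp add: changes_def)
qed

lemma changes_Suc_le: "changes a (Suc i) \<le> Suc (changes a i)"
  by (simp add: changes_Suc)

lemma changes_mono: "i \<le> j \<Longrightarrow> changes a i \<le> changes a j"
  by (rule lift_Suc_mono_le) (auto simp: changes_Suc)

lemma changes_less:
  fixes a :: "nat \<Rightarrow> 'd::linorder"
  assumes "mono a" "a i < a j"
  shows "changes a i < changes a j"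
proof -
  have "i \<le> j" using assms by (metis linorder_not_le monoD nat_le_linear)
  then show ?thesis using assms(2)
  proof (induction j rule: dec_induct)
    case (step j)
    show ?case
    proof (cases "a i < a j")
      case True
      then show ?thesis using step.IH changes_mono[of j "Suc j" a] by simp
    next
      case False
      then have "a (Suc j) \<noteq> a j" using step.prems by auto
      then show ?thesis using changes_mono[OF step.hyps(1), of a] by (simp add: changes_Suc)
    qed
  qed simp
qed

lemma changes_less_iff:
  fixes a :: "nat \<Rightarrow> 'd::linorder"
  assumes "mono a"
  shows "changes a i < changes a j \<longleftrightarrow> a i < a j"
proof
  assume *: "changes a i < changes a j"
  show "a i < a j"
  proof (rule ccontr)
    assume "\<not> a i < a j"
    then consider "a j < a i" | "a i = a j" by fastforce
    then show False
    proof cases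
      case 1
      then show False using changes_less[OF assms 1] * by simp
    next
      case 2
      have "i \<le> j" using * changes_mono[of j i a] by (meson linorder_not_le nat_le_linear)
      have const: "a k = a i" if "i \<le> k" "k \<le> j" for k
        using monoD[OF assms that(1)] monoD[OF assms that(2)] 2 by simp
      have same: "changes a k = changes a i" if "i \<le> k" "k \<le> j" for k
        using that
      proof (induction k rule: dec_induct)
        case (step k)
        then show ?case using const[of k] const[of "Suc k"] by (simp add: changes_Suc)
      qed simp
      show False using less_not_refl2[OF *] same[OF \<open>i \<le> j\<close> order_refl] by (rule notE)
    qed
  qed
qed (rule changes_less[OF assms])

text \<open>In a monotone sequence the number of earlier changes is the rank of the current value
  among the values taken. Equality and order of data thereby become equality and order of
  naturals.\<close>

lemma changes_eq_iff:
  fixes a :: "nat \<Rightarrow> 'd::linorder"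
  assumes "mono a"
  shows "changes a i = changes a j \<longleftrightarrow> a i = a j"
  using changes_less_iff[OF assms, of i j] changes_less_iff[OF assms, of j i]
  by (cases "a i" "a j" rule: linorder_cases) auto

text \<open>The sequence \<open>b\<close> cannot skip a value of \<open>a\<close>. Were a value of
  \<open>a\<close> strictly between \<open>b i\<close> and \<open>b (Suc i)\<close>, it would have
  to recur in \<open>b\<close>, which is impossible for a monotone \<open>b\<close>. So each change
  of \<open>b\<close> moves to the next rank in \<open>a\<close>.\<close>

lemma paired_changes:
  assumes p: "paired a b"
  shows "\<exists>j\<le>i. b i = a j \<and> changes b i = changes a j"
proof (induction i)
  case 0
  have "b 0 = a 0" using p unfolding paired_def by (metis le_zero_eq)
  then show ?case by (auto simp: changes_0)
next
  case (Suc i)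
  then obtain j where j: "j \<le> i" "b i = a j" "changes b i = changes a j" by blast
  have a: "mono a" and b: "mono b" using p by (auto simp: paired_def)
  show ?case
  proof (cases "b (Suc i) = b i")
    case True
    then show ?thesis using j by (auto simp: changes_Suc intro: le_SucI)
  next
    case False
    then have less: "b i < b (Suc i)" using b by (simp add: monoD order.not_eq_order_implies_strict)
    obtain k where k: "k \<le> Suc i" "b (Suc i) = a k" using p by (metis paired_def)
    have jk: "changes a j < changes a k" using less j k by (simp add: changes_less_iff[OF a])
    have "changes a k = Suc (changes a j)"
    proof (rule ccontr)
      assume "changes a k \<noteq> Suc (changes a j)"
      then have skip: "Suc (changes a j) < changes a k" using jk by simp
      have "j \<le> k" using jk changes_mono[of k j a] by (meson linorder_not_le nat_le_linear)
      then obtain l where l: "changes a l = Suc (changes a j)"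
        using nat_intermediate_value[of "changes a" j k "Suc (changes a j)"] skip changes_Suc_le
        by auto
      obtain m where m: "b m = a l" using p by (metis paired_def)
      have "b i < b m" "b m < b (Suc i)"
        using l skip j k m by (simp_all flip: changes_less_iff[OF a])
      then show False using b by (metis linorder_not_le monoD not_less_eq_eq)
    qed
    then show ?thesis using False j k by (auto simp: changes_Suc)
  qed
qed

text \<open>The counter is the difference of the two ranks. Truncation does no harm, since
  \<open>b\<close> only takes values that \<open>a\<close> has already reached.\<close>

lemma paired_counts:
  assumes p: "paired a b"
  shows "\<exists>c. counts a b c \<and> c 0 = 0"
proof (intro exI conjI)
  let ?c = "\<lambda>i. changes a i - changes b i"
  have a: "mono a" using p by (auto simp: paired_def)
  have le: "changes b i \<le> changes a i" for i
    using paired_changes[OF p, of i] changes_mono[of _ i a] by auto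
  have eq: "a i = b i \<longleftrightarrow> changes a i = changes b i" for i
    using paired_changes[OF p, of i] changes_eq_iff[OF a] by auto
  show "counts a b ?c"
    unfolding counts_def
  proof
    fix i
    have one: "a (Suc i) = a i \<or> b (Suc i) = b i" using p by (auto simp: paired_def)
    show "(a (Suc i) \<noteq> a i \<and> b (Suc i) = b i \<longleftrightarrow> ?c (Suc i) = Suc (?c i)) \<and>
     (a (Suc i) = a i \<and> b (Suc i) \<noteq> b i \<longleftrightarrow> ?c i = Suc (?c (Suc i))) \<and>
     (a (Suc i) = a i \<and> b (Suc i) = b i \<longleftrightarrow> ?c (Suc i) = ?c i) \<and>
     (a i = b i \<longleftrightarrow> ?c i = 0)"
      using one le[of i] le[of "Suc i"] eq[of i] by (auto simp: changes_Suc)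
  qed
qed (simp add: changes_0)

section \<open>Realizing counters in an infinite linear order\<close>

lemma infinite_linorder_chain:
  assumes "infinite (UNIV :: 'd::linorder set)"
  shows "\<exists>e :: nat \<Rightarrow> 'd. strict_mono_on {..n} e"
proof -
  obtain X :: "'d set" where X: "finite X" "card X = Suc n"
    using infinite_arbitrarily_large[OF assms] by blast
  then have "strict_mono_on {..n} (\<lambda>i. sorted_list_of_set X ! i)"
    using sorted_wrt_nth_less[OF strict_sorted_list_of_set[of X]]
    by (auto intro!: strict_mono_onI)
  then show ?thesis by blast
qed

lemma counts_paired:
  assumes inf: "infinite (UNIV :: 'd::linorder set)"
    and up: "\<And>i. c (Suc i) \<le> Suc (c i)" and down: "\<And>i. c i \<le> Suc (c (Suc i))"
    and c0: "c 0 = 0" and end0: "\<And>i. N \<le> i \<Longrightarrow> c i = 0"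
  shows "\<exists>a b :: nat \<Rightarrow> 'd. paired a b \<and> counts a b c"
proof -
  \<comment> \<open>By truncation, \<open>A\<close> sums only the increments before \<open>i\<close>
    and \<open>B\<close> only the decrements; hence \<open>A i = B i + c i\<close>.\<close>
  define A where "A i = (\<Sum>j<i. c (Suc j) - c j)" for i
  define B where "B i = (\<Sum>j<i. c j - c (Suc j))" for i
  have A_Suc: "A (Suc i) = A i + (c (Suc i) - c i)" for i by (simp add: A_def)
  have B_Suc: "B (Suc i) = B i + (c i - c (Suc i))" for i by (simp add: B_def)
  have AB: "A i = B i + c i" for i
  proof (induction i)
    case 0
    show ?case by (simp add: A_def B_def c0)
  next
    case (Suc i)
    then show ?case by (simp add: A_Suc B_Suc)
  qed
  have A_mono: "i \<le> j \<Longrightarrow> A i \<le> A j" for i j by (rule lift_Suc_mono_le) (auto simp: A_Suc)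
  have B_mono: "i \<le> j \<Longrightarrow> B i \<le> B j" for i j by (rule lift_Suc_mono_le) (auto simp: B_Suc)
  have A_step: "A (Suc i) \<le> Suc (A i)" for i using up[of i] by (simp add: A_Suc)
  have B_step: "B (Suc i) \<le> Suc (B i)" for i using down[of i] by (simp add: B_Suc)
  have A_N: "A i = A N" if "N \<le> i" for i
    using that by (induction i rule: dec_induct) (simp_all add: A_Suc end0)
  have A_le: "A i \<le> A N" for i
    using A_mono[of i N] A_N[of i] by (metis nat_le_linear order_refl)
  have B_le: "B i \<le> A N" for i using AB[of i] A_le[of i] by simp
  \<comment> \<open>All ranks are at most \<open>A N\<close>, so a finite chain is enough. An
    infinite ascending one need not exist, as the negative integers show.\<close>
  obtain e :: "nat \<Rightarrow> 'd" where e: "strict_mono_on {..A N} e"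
    using infinite_linorder_chain[OF inf] by blast
  have e_eq: "e x = e y \<longleftrightarrow> x = y" if "x \<le> A N" "y \<le> A N" for x y
    using strict_mono_on_eqD[OF e] that by auto
  have e_mono: "e x \<le> e y" if "x \<le> y" "y \<le> A N" for x y
    using strict_mono_onD[OF e, of x y] that by (cases "x = y") auto
  let ?a = "\<lambda>i. e (A i)" and ?b = "\<lambda>i. e (B i)"
  have "paired ?a ?b"
    unfolding paired_def
  proof (intro conjI allI)
    show "mono ?a" by (intro monoI e_mono A_mono A_le)
    show "mono ?b" by (intro monoI e_mono B_mono B_le)
    show "\<exists>j\<le>i. ?b i = ?a j" for i
      using nat_intermediate_value[of A 0 i "B i"] A_step AB[of i]
      by (auto simp: A_def[of 0])
    show "\<exists>j\<ge>i. ?a i = ?b j" for i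
    proof -
      \<comment> \<open>From \<open>N\<close> on the counter is zero and \<open>B\<close> has caught
        up with \<open>A\<close>. Since \<open>B\<close> grows by at most one at a time, it meets
        the value \<open>A i\<close> on the way.\<close>
      have "A i \<le> B (max i N)" using AB[of "max i N"] end0[of "max i N"] A_mono[of i "max i N"] by simp
      then show ?thesis
        using nat_intermediate_value[of B i "max i N" "A i"] B_step AB[of i] by auto
    qed
    show "?a (Suc i) = ?a i \<or> ?b (Suc i) = ?b i" for i
      by (cases "c i \<le> c (Suc i)") (simp_all add: A_Suc B_Suc)
  qed
  moreover have "counts ?a ?b c"
    unfolding counts_def
  proof
    fix i
    have "?a (Suc i) = ?a i \<longleftrightarrow> c (Suc i) \<le> c i" "?b (Suc i) = ?b i \<longleftrightarrow> c i \<le> c (Suc i)"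
      "?a i = ?b i \<longleftrightarrow> c i = 0"
      unfolding e_eq[OF A_le A_le] e_eq[OF B_le B_le] e_eq[OF A_le B_le]
      by (simp_all add: A_Suc B_Suc AB[of i])
    then show "(?a (Suc i) \<noteq> ?a i \<and> ?b (Suc i) = ?b i \<longleftrightarrow> c (Suc i) = Suc (c i)) \<and>
     (?a (Suc i) = ?a i \<and> ?b (Suc i) \<noteq> ?b i \<longleftrightarrow> c i = Suc (c (Suc i))) \<and>
     (?a (Suc i) = ?a i \<and> ?b (Suc i) = ?b i \<longleftrightarrow> c (Suc i) = c i) \<and>
     (?a i = ?b i \<longleftrightarrow> c i = 0)"
      using up[of i] down[of i] by auto
  qed
  ultimately show ?thesis by blast
qed

section \<open>The formula of a program\<close>

text \<open>Continuations have to be numbered by \<open>to_nat\<close> in order to become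
  variables.\<close>

instance cmd :: countable
  by countable_datatype

definition ttrue :: lrct where
  "ttrue = TEqXi 0 0 0"

definition tor :: "lrct \<Rightarrow> lrct \<Rightarrow> lrct" where
  "tor \<phi> \<psi> = TNot (TAnd (TNot \<phi>) (TNot \<psi>))"

definition timp :: "lrct \<Rightarrow> lrct \<Rightarrow> lrct" where
  "timp \<phi> \<psi> = TNot (TAnd \<phi> (TNot \<psi>))"

definition teventually :: "lrct \<Rightarrow> lrct" where
  "teventually \<phi> = TUntil ttrue \<phi>"

definition talways :: "lrct \<Rightarrow> lrct" where
  "talways \<phi> = TNot (teventually (TNot \<phi>))"

definition tconj :: "lrct list \<Rightarrow> lrct" where
  "tconj \<phi>s = foldr TAnd \<phi>s ttrue"

lemma holds_t_derived [simp]: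
  "holds_t \<sigma> i ttrue"
  "holds_t \<sigma> i (tor \<phi> \<psi>) \<longleftrightarrow> holds_t \<sigma> i \<phi> \<or> holds_t \<sigma> i \<psi>"
  "holds_t \<sigma> i (timp \<phi> \<psi>) \<longleftrightarrow> (holds_t \<sigma> i \<phi> \<longrightarrow> holds_t \<sigma> i \<psi>)"
  "holds_t \<sigma> i (teventually \<phi>) \<longleftrightarrow> (\<exists>j\<ge>i. holds_t \<sigma> j \<phi>)"
  "holds_t \<sigma> i (talways \<phi>) \<longleftrightarrow> (\<forall>j\<ge>i. holds_t \<sigma> j \<phi>)"
  by (auto simp: ttrue_def tor_def timp_def teventually_def talways_def)

lemma holds_tconj [simp]: "holds_t \<sigma> i (tconj \<phi>s) \<longleftrightarrow> (\<forall>\<phi>\<in>set \<phi>s. holds_t \<sigma> i \<phi>)"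
  unfolding tconj_def by (induction \<phi>s) auto

text \<open>Variable 0 is constant, and a proposition is encoded as a variable being equal to it.
  Variable 1 is the proposition marking the position at which the input has been loaded.\<close>

definition inc_var :: "nat \<Rightarrow> nat" where
  "inc_var r = 5 * r + 2"

definition dec_var :: "nat \<Rightarrow> nat" where
  "dec_var r = 5 * r + 3"

definition cont_var :: "cmd list \<Rightarrow> nat" where
  "cont_var K = 5 * to_nat K + 4"

definition loaded :: lrct where
  "loaded = TEqXi 1 0 0"

definition at_cont :: "cmd list \<Rightarrow> lrct" where
  "at_cont K = TEqXi (cont_var K) 0 0"

definition keeps :: "nat \<Rightarrow> lrct" where
  "keeps x = TEqXi x 1 x"

lemma holds_keeps: "holds_t \<sigma> i (keeps x) \<longleftrightarrow> \<sigma> (Suc i) x = \<sigma> i x"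
  by (auto simp: keeps_def)

text \<open>The modalities \<open>TEqXFinv\<close> and \<open>TEqXF\<close> look strictly into the
  past and the future; the disjunctions add the present position, as \<open>paired\<close>
  demands.\<close>

definition counter_fm :: "nat \<Rightarrow> lrct" where
  "counter_fm r = (let a = inc_var r; b = dec_var r in tconj
    [talways (TNot (TGtXF a a)), talways (TNot (TGtXF b b)),
     talways (tor (TEqXi b 0 a) (TEqXFinv b a)), talways (tor (TEqXi a 0 b) (TEqXF a b)),
     talways (tor (keeps a) (keeps b))])"

definition effect_reg_fm :: "cmd \<Rightarrow> nat \<Rightarrow> lrct" where
  "effect_reg_fm c r = (let a = inc_var r; b = dec_var r in
     TAnd (if c = Inc r then TAnd (TNot (keeps a)) (keeps b)
       else if c = Dec r then TAnd (keeps a) (TNot (keeps b)) else TAnd (keeps a) (keeps b))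
     (if c = IsZ r then TEqXi a 0 b else ttrue))"

definition effect_fm :: "nat \<Rightarrow> cmd \<Rightarrow> lrct" where
  "effect_fm R c = tconj (map (effect_reg_fm c) [0..<R])"

fun step_fm :: "nat \<Rightarrow> cmd list \<Rightarrow> lrct" where
  "step_fm R [] = ttrue"
| "step_fm R (c # K) = TAnd (effect_fm R c)
     (TNext (TNot (tconj (map (\<lambda>L. TNot (at_cont L)) (succs c K)))))"

text \<open>Register 0 is incremented up to the only position where \<open>loaded\<close> holds, and
  there the program starts. The atom \<open>TEqXi 0 n 1\<close> puts that position at
  \<open>n\<close>, so the input is \<open>n\<close> although this formula does not mention it.
  Since eventually no continuation from \<open>conts P []\<close> is marked, the run has to exit
  through the empty one.\<close>

definition program_fm :: "nat \<Rightarrow> cmd \<Rightarrow> lrct" where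
  "program_fm R P = tconj
    ([talways (keeps 0),
      TUntil (TAnd (TNot loaded) (effect_fm R (Inc 0)))
        (TAnd loaded (TAnd (TNext (talways (TNot loaded))) (at_cont [P]))),
      teventually (talways (tconj (map (\<lambda>K. TNot (at_cont K)) (conts P []))))]
     @ map counter_fm [0..<R]
     @ map (\<lambda>K. talways (timp (at_cont K) (step_fm R K))) (conts P []))"

section \<open>Semantics of the counter and effect formulas\<close>

lemma mono_iff_no_later_less:
  "mono f \<longleftrightarrow> (\<forall>i::nat. \<not> (\<exists>j>i. (f i :: 'a::linorder) > f j))"
proof
  assume *: "\<forall>i. \<not> (\<exists>j>i. f i > f j)"
  show "mono f"
  proof (rule monoI)
    fix i j :: nat assume "i \<le> j"
    then have "\<not> f j < f i" using * by (cases "i = j") auto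
    then show "f i \<le> f j" by simp
  qed
next
  assume "mono f"
  then have "f i \<le> f j" if "i < j" for i j using that by (simp add: monoD)
  then show "\<forall>i. \<not> (\<exists>j>i. f i > f j)" by (metis not_less)
qed

lemma holds_counter_fm:
  "holds_t \<sigma> 0 (counter_fm r) \<longleftrightarrow> paired (\<lambda>i. \<sigma> i (inc_var r)) (\<lambda>i. \<sigma> i (dec_var r))"
proof -
  have past: "(\<exists>j\<le>i. x = f j) \<longleftrightarrow> x = f i \<or> (\<exists>j<i. x = f j)" for x :: 'a and f and i :: nat
    by (auto simp: le_less)
  have future: "(\<exists>j\<ge>i. x = f j) \<longleftrightarrow> x = f i \<or> (\<exists>j>i. x = f j)" for x :: 'a and f and i :: nat
    by (auto simp: le_less)
  show ?thesis
    unfolding counter_fm_def paired_def mono_iff_no_later_less past future Let_def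
    by (auto simp: holds_keeps)
qed

definition tracks :: "(nat \<Rightarrow> nat \<Rightarrow> 'd) \<Rightarrow> nat \<Rightarrow> (nat \<Rightarrow> nat \<Rightarrow> nat) \<Rightarrow> bool" where
  "tracks \<sigma> R S \<longleftrightarrow>
     (\<forall>r<R. counts (\<lambda>i. \<sigma> i (inc_var r)) (\<lambda>i. \<sigma> i (dec_var r)) (\<lambda>i. S i r))"

lemma holds_effect_reg_fm:
  assumes "tracks \<sigma> R S" "r < R"
  shows "holds_t \<sigma> i (effect_reg_fm c r) \<longleftrightarrow>
    (if c = Inc r then S (Suc i) r = Suc (S i r)
     else if c = Dec r then S i r = Suc (S (Suc i) r) else S (Suc i) r = S i r) \<and>
    (c = IsZ r \<longrightarrow> S i r = 0)"
proof -
  have c: "counts (\<lambda>i. \<sigma> i (inc_var r)) (\<lambda>i. \<sigma> i (dec_var r)) (\<lambda>i. S i r)"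
    using assms by (auto simp: tracks_def)
  show ?thesis
    using c[unfolded counts_def, rule_format, of i]
    by (simp add: effect_reg_fm_def Let_def holds_keeps)
qed

lemma holds_effect_fm:
  assumes "tracks \<sigma> R S"
  shows "holds_t \<sigma> i (effect_fm R c) \<longleftrightarrow> (\<forall>r<R.
    (if c = Inc r then S (Suc i) r = Suc (S i r)
     else if c = Dec r then S i r = Suc (S (Suc i) r) else S (Suc i) r = S i r) \<and>
    (c = IsZ r \<longrightarrow> S i r = 0))"
proof -
  have "holds_t \<sigma> i (effect_fm R c) \<longleftrightarrow> (\<forall>r<R. holds_t \<sigma> i (effect_reg_fm c r))"
    by (auto simp: effect_fm_def)
  then show ?thesis using holds_effect_reg_fm[OF assms] by simp
qed

lemma effect_fm_complete:
  "tracks \<sigma> R S \<Longrightarrow> effect c (S i) (S (Suc i)) \<Longrightarrow> holds_t \<sigma> i (effect_fm R c)"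
  unfolding effect_def by (subst holds_effect_fm) auto

text \<open>The formula constrains only registers below \<open>R\<close>. Beyond them
  \<open>S\<close> is constantly zero and \<open>c\<close> acts on none, so nothing is lost.\<close>

lemma effect_fm_sound:
  assumes "tracks \<sigma> R S" "holds_t \<sigma> i (effect_fm R c)" "reg_bound c \<le> R"
    and zero: "\<And>i r. R \<le> r \<Longrightarrow> S i r = 0"
  shows "effect c (S i) (S (Suc i))"
proof -
  have e: "(if c = Inc r then S (Suc i) r = Suc (S i r)
     else if c = Dec r then S i r = Suc (S (Suc i) r) else S (Suc i) r = S i r) \<and>
    (c = IsZ r \<longrightarrow> S i r = 0)" for r
  proof (cases "r < R")
    case True
    then show ?thesis using assms(2) unfolding holds_effect_fm[OF assms(1)] by blast
  next
    case False
    then show ?thesis using assms(3) zero by auto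
  qed
  show ?thesis unfolding effect_def using e by blast
qed

section \<open>From models to terminating runs\<close>

lemma program_fm_sound:
  fixes \<sigma> :: "nat \<Rightarrow> nat \<Rightarrow> 'd::linorder"
  assumes fm: "holds_t \<sigma> 0 (TAnd (program_fm R P) (TEqXi 0 n 1))"
    and R: "reg_bound P \<le> R" "0 < R"
  shows "\<exists>s'. s' \<in> exec P ((\<lambda>_. 0)(0 := n))"
proof -
  have const: "\<sigma> (Suc i) 0 = \<sigma> i 0" for i
    using fm by (simp add: program_fm_def holds_keeps)
  then have const: "\<sigma> i 0 = \<sigma> 0 0" for i by (induction i) simp_all
  have "\<exists>m. (\<forall>i<m. \<not> holds_t \<sigma> i loaded \<and> holds_t \<sigma> i (effect_fm R (Inc 0))) \<and>
      holds_t \<sigma> m (at_cont [P]) \<and> (\<forall>i>m. \<not> holds_t \<sigma> i loaded)"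
    using fm by (auto simp: program_fm_def Suc_le_eq)
  then obtain m where loading: "\<And>i. i < m \<Longrightarrow> \<not> holds_t \<sigma> i loaded"
      "\<And>i. i < m \<Longrightarrow> holds_t \<sigma> i (effect_fm R (Inc 0))"
    and m: "holds_t \<sigma> m (at_cont [P])"
    and after: "\<And>i. m < i \<Longrightarrow> \<not> holds_t \<sigma> i loaded"
    by blast
  \<comment> \<open>Variable 0 is constant, so its value at position 0 in the input atom may be
    compared with variable 1 at position \<open>n\<close>.\<close>
  have "holds_t \<sigma> n loaded" using fm const[of n] by (simp add: loaded_def)
  then have "m = n" using loading(1)[of n] after[of n] by (cases m n rule: linorder_cases) auto
  obtain N where "\<And>i K. N \<le> i \<Longrightarrow> K \<in> set (conts P []) \<Longrightarrow> \<not> holds_t \<sigma> i (at_cont K)"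
    using fm by (auto simp: program_fm_def)
  then have bounded: "i < N" if "holds_t \<sigma> i (at_cont K)" "K \<in> set (conts P [])" for i K
    using that by (meson not_le)
  have trans: "holds_t \<sigma> i (step_fm R K)" if "holds_t \<sigma> i (at_cont K)" "K \<in> set (conts P [])" for i K
  proof -
    have "\<forall>K\<in>set (conts P []). holds_t \<sigma> 0 (talways (timp (at_cont K) (step_fm R K)))"
      using fm by (simp add: program_fm_def ball_Un)
    then show ?thesis using that by simp
  qed
  have "\<forall>r<R. \<exists>c. counts (\<lambda>i. \<sigma> i (inc_var r)) (\<lambda>i. \<sigma> i (dec_var r)) c \<and> c 0 = 0"
  proof -
    have "\<forall>r<R. holds_t \<sigma> 0 (counter_fm r)"
      using fm by (auto simp: program_fm_def ball_Un)
    then show ?thesis using paired_counts unfolding holds_counter_fm by blast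
  qed
  then obtain C where C: "\<And>r. r < R \<Longrightarrow>
      counts (\<lambda>i. \<sigma> i (inc_var r)) (\<lambda>i. \<sigma> i (dec_var r)) (C r) \<and> C r 0 = 0"
    by metis
  define S where "S i r = (if r < R then C r i else 0)" for i r
  have tracks: "tracks \<sigma> R S"
    using C by (simp add: tracks_def S_def)
  have zero: "S i r = 0" if "R \<le> r" for i r using that by (simp add: S_def)
  have load: "S i = (\<lambda>_. 0)(0 := i)" if "i \<le> n" for i
    using that
  proof (induction i)
    case 0
    show ?case using C by (auto simp: S_def fun_eq_iff)
  next
    case (Suc i)
    have "effect (Inc 0) (S i) (S (Suc i))"
      using loading(2)[of i] Suc.prems R \<open>m = n\<close> zero
      by (intro effect_fm_sound[OF tracks]) auto
    then show ?case using Suc by (auto simp: effect_Inc fun_eq_iff)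
  qed
  have progress: "\<exists>K'. step (K, S i) (K', S (Suc i)) \<and> (K' = [] \<or>
      K' \<in> set (conts P []) \<and> holds_t \<sigma> (Suc i) (at_cont K'))"
    if K: "K \<in> set (conts P [])" "holds_t \<sigma> i (at_cont K)" for i K
  proof -
    obtain c L where cL: "K = c # L" using conts_nonempty[OF K(1)] by (cases K) auto
    have "\<forall>c\<in>set K. reg_bound c \<le> R" by (rule conts_reg_bound[OF K(1) R(1)]) simp
    then have "reg_bound c \<le> R" using cL by simp
    moreover have "holds_t \<sigma> i (effect_fm R c)" using trans[OF K(2,1)] cL by simp
    ultimately have "effect c (S i) (S (Suc i))" using zero by (intro effect_fm_sound[OF tracks])
    moreover obtain K' where K': "K' \<in> set (succs c L)" "holds_t \<sigma> (Suc i) (at_cont K')"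
      using trans[OF K(2,1)] cL by auto
    moreover have "K' = [] \<or> K' \<in> set (conts P [])"
      using conts_closed[of c L P "[]"] K(1) cL K'(1) by simp
    ultimately show ?thesis using cL by (auto intro: step.intros)
  qed
  have "\<exists>s'. step\<^sup>*\<^sup>* (K, S i) ([], s')"
    if "K \<in> set (conts P [])" "holds_t \<sigma> i (at_cont K)" for i K
    using that
  \<comment> \<open>Several continuations may be marked at one position; following any one of them
    gives a run. The marks stop before \<open>N\<close>, so \<open>N - i\<close> decreases and the
    run terminates.\<close>
  proof (induction "N - i" arbitrary: i K rule: less_induct)
    case less
    obtain K' where K': "step (K, S i) (K', S (Suc i))"
      "K' = [] \<or> K' \<in> set (conts P []) \<and> holds_t \<sigma> (Suc i) (at_cont K')"
      using progress[OF less.prems] by blast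
    have "N - Suc i < N - i" using bounded[OF less.prems(2,1)] by simp
    then have "\<exists>s'. step\<^sup>*\<^sup>* (K', S (Suc i)) ([], s')"
      using K'(2) less.hyps[of "Suc i" K'] by blast
    then show ?case using K'(1) by (meson converse_rtranclp_into_rtranclp)
  qed
  then obtain s' where "step\<^sup>*\<^sup>* ([P], S n) ([], s')"
    using conts_start[of P "[]"] m \<open>m = n\<close> by blast
  then have "s' \<in> execs [P] (S n)" by (rule execs_steps)
  then show ?thesis by (auto simp: load)
qed

section \<open>From runs ending in zero to models\<close>

lemma program_fm_complete:
  assumes inf: "infinite (UNIV :: 'd::linorder set)"
    and run: "(\<lambda>_. 0) \<in> exec P ((\<lambda>_. 0)(0 := n))"
  shows "\<exists>\<sigma> :: nat \<Rightarrow> nat \<Rightarrow> 'd. holds_t \<sigma> 0 (TAnd (program_fm R P) (TEqXi 0 n 1))"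
proof -
  obtain m where "(step ^^ m) ([P], (\<lambda>_. 0)(0 := n)) ([], \<lambda>_. 0)"
    using exec_steps[OF run] rtranclp_imp_relpowp by fast
  then obtain f where f: "f 0 = ([P], (\<lambda>_. 0)(0 := n))" "f m = ([], \<lambda>_. 0)"
    "\<And>i. i < m \<Longrightarrow> step (f i) (f (Suc i))"
    unfolding relpowp_fun_conv by blast
  \<comment> \<open>The first \<open>n\<close> steps load the input, the next \<open>m\<close>
    follow the run, and \<open>min\<close> freezes the all-zero final state from then on.\<close>
  define S where "S i = (if i \<le> n then (\<lambda>_. 0)(0 := i) else snd (f (min (i - n) m)))" for i
  define M where "M i = {K. \<exists>j\<le>m. i = n + j \<and> K = fst (f j)}" for i
  have S_run: "S (n + j) = snd (f j)" if "j \<le> m" for j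
    using that f(1) by (cases j) (auto simp: S_def)
  have S_end: "S i = (\<lambda>_. 0)" if "n + m \<le> i" for i
  proof -
    have "min (i - n) m = m" using that by simp
    then show ?thesis using that f(1,2) by (cases "i = n") (auto simp: S_def)
  qed
  have S_load: "effect (Inc 0) (S i) (S (Suc i))" if "i < n" for i
    using that by (auto simp: effect_Inc S_def fun_eq_iff)
  have S_step: "\<exists>c K. fst (f j) = c # K \<and> effect c (S (n + j)) (S (Suc (n + j))) \<and>
      fst (f (Suc j)) \<in> set (succs c K)" if "j < m" for j
    using f(3)[OF that] S_run[of j] S_run[of "Suc j"] that
    by (auto elim!: step.cases)
  have S_unit: "S (Suc i) r \<le> Suc (S i r) \<and> S i r \<le> Suc (S (Suc i) r)" for i r
  proof -
    have unit: "s' r \<le> Suc (s r) \<and> s r \<le> Suc (s' r)" if "effect c s s'" for c s s'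
      using that[unfolded effect_def, THEN conjunct1, rule_format, of r] by (auto split: if_splits)
    consider "i < n" | j where "i = n + j" "j < m" | "n + m \<le> i"
      by (metis add_diff_inverse_nat nat_add_left_cancel_less not_le)
    then show ?thesis
    proof cases
      case 1
      then show ?thesis using unit S_load by blast
    next
      case 2
      then show ?thesis using unit S_step by blast
    next
      case 3
      then show ?thesis by (simp add: S_end)
    qed
  qed
  have S_start: "S 0 r = 0" for r by (simp add: S_def)
  have "\<exists>a b :: nat \<Rightarrow> 'd. paired a b \<and> counts a b (\<lambda>i. S i r)" for r
    using S_unit S_end S_start by (intro counts_paired[OF inf, where N = "n + m"]) auto
  then obtain a b :: "nat \<Rightarrow> nat \<Rightarrow> 'd" where
    ab: "\<And>r. paired (a r) (b r)" "\<And>r. counts (a r) (b r) (\<lambda>i. S i r)"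
    by metis
  obtain d e :: 'd where "d \<noteq> e"
    using inf by (metis (full_types) finite.simps UNIV_I finite_subset insertCI subsetI)
  \<comment> \<open>The residue modulo 5 separates the constant, the loading mark, the two kinds of
    counter variables and the continuations. Truth is coded by the value \<open>d\<close> of
    variable 0, falsity by \<open>e\<close>.\<close>
  define \<sigma> where "\<sigma> i v =
    (if v mod 5 = 0 then d
     else if v mod 5 = 1 then (if i = n then d else e)
     else if v mod 5 = 2 then a (v div 5) i
     else if v mod 5 = 3 then b (v div 5) i
     else if from_nat (v div 5) \<in> M i then d else e)" for i v
  have \<sigma>: "\<sigma> i 0 = d" "\<sigma> i 1 = (if i = n then d else e)" "\<sigma> i (inc_var r) = a r i"
    "\<sigma> i (dec_var r) = b r i" "\<sigma> i (cont_var K) = (if K \<in> M i then d else e)" for i r K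
  proof -
    have mods: "(5 * q + 2) mod 5 = 2" "(5 * q + 2) div 5 = q" "(5 * q + 3) mod 5 = 3"
      "(5 * q + 3) div 5 = q" "(5 * q + 4) mod 5 = 4" "(5 * q + 4) div 5 = q" for q :: nat
      by presburger+
    show "\<sigma> i 0 = d" "\<sigma> i 1 = (if i = n then d else e)" "\<sigma> i (inc_var r) = a r i"
      "\<sigma> i (dec_var r) = b r i" "\<sigma> i (cont_var K) = (if K \<in> M i then d else e)"
      unfolding \<sigma>_def inc_var_def dec_var_def cont_var_def mods by simp_all
  qed
  have loaded: "holds_t \<sigma> i loaded \<longleftrightarrow> i = n" for i
    using \<open>d \<noteq> e\<close> \<sigma>(1,2)[of i] by (simp add: loaded_def)
  have at_cont: "holds_t \<sigma> i (at_cont K) \<longleftrightarrow> K \<in> M i" for i K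
    using \<open>d \<noteq> e\<close> by (simp add: at_cont_def \<sigma>)
  have tracks: "tracks \<sigma> R S" using ab(2) by (simp add: tracks_def \<sigma>)
  have "holds_t \<sigma> 0 (talways (keeps 0))" by (simp add: holds_keeps \<sigma>)
  moreover have "holds_t \<sigma> 0 (TUntil (TAnd (TNot loaded) (effect_fm R (Inc 0)))
        (TAnd loaded (TAnd (TNext (talways (TNot loaded))) (at_cont [P]))))"
  proof -
    have "[P] \<in> M n" using f(1) by (auto simp: M_def)
    then show ?thesis
      using effect_fm_complete[OF tracks S_load] by (auto simp: loaded at_cont)
  qed
  moreover have "holds_t \<sigma> 0
      (teventually (talways (tconj (map (\<lambda>K. TNot (at_cont K)) (conts P [])))))"
  proof -
    \<comment> \<open>The run still marks the empty continuation at position \<open>n + m\<close>;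
      after that position nothing is marked.\<close>
    have "M j = {}" if "Suc (n + m) \<le> j" for j using that by (auto simp: M_def)
    then show ?thesis by (auto simp: at_cont intro!: exI[of _ "Suc (n + m)"])
  qed
  moreover have "holds_t \<sigma> 0 (counter_fm r)" for r
    using ab(1) by (simp add: holds_counter_fm \<sigma>)
  moreover have "holds_t \<sigma> 0 (talways (timp (at_cont K) (step_fm R K)))"
    if "K \<in> set (conts P [])" for K
  proof -
    have "holds_t \<sigma> i (step_fm R K)" if "K \<in> M i" for i
    proof -
      obtain j where j: "j \<le> m" "i = n + j" "K = fst (f j)" using \<open>K \<in> M i\<close> by (auto simp: M_def)
      have "j \<noteq> m" using conts_nonempty[OF \<open>K \<in> set (conts P [])\<close>] j(3) f(2) by auto
      then have "j < m" using j(1) by simp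
      then obtain c L where cL: "K = c # L" "effect c (S i) (S (Suc i))"
        "fst (f (Suc j)) \<in> set (succs c L)"
        using S_step[of j] j by auto
      have "fst (f (Suc j)) \<in> M (Suc i)" using \<open>j < m\<close> j(2) by (auto simp: M_def)
      then show ?thesis using cL effect_fm_complete[OF tracks cL(2)] by (auto simp: at_cont)
    qed
    then show ?thesis by (simp add: at_cont)
  qed
  moreover have "holds_t \<sigma> 0 (TEqXi 0 n 1)" using \<sigma>(1)[of 0] \<sigma>(2)[of n] by simp
  ultimately have "holds_t \<sigma> 0 (TAnd (program_fm R P) (TEqXi 0 n 1))"
    by (auto simp: program_fm_def simp del: step_fm.simps)
  then show ?thesis by blast
qed

section \<open>Diagonalization\<close>

text \<open>Clearing the input makes all registers zero at the end, which the construction of a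
  model from a run requires.\<close>

definition halting_program :: "recf \<Rightarrow> cmd" where
  "halting_program q = Seq (compile q [0] 1) (Seq (IsZ 1) (clear 0))"

lemma exec_halting_program:
  "exec (halting_program q) ((\<lambda>_. 0)(0 := n)) = (if reval q [n] 0 then {\<lambda>_. 0} else {})"
proof -
  let ?s = "(\<lambda>_. 0)(0 := n) :: nat \<Rightarrow> nat"
  have "exec (compile q [0] 1) ?s = {?s(1 := z) | z. reval q (map ?s [0]) z}"
    by (rule implementsD[OF implements_compile]) auto
  moreover have "exec (Seq (IsZ 1) (clear 0)) (?s(1 := z)) = (if z = 0 then {\<lambda>_. 0} else {})" for z
    by (auto simp: exec_clear fun_eq_iff)
  ultimately show ?thesis
    unfolding halting_program_def exec.simps(4)[of "compile _ _ _"] by (simp only: UN_Collect_eq) auto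
qed

definition halting_fm :: "recf \<Rightarrow> lrct" where
  "halting_fm q = (let P = halting_program q in program_fm (Suc (reg_bound P)) P)"

text \<open>The formula \<open>halting_fm q\<close> does not depend on \<open>n\<close>, so its own
  code may be taken for \<open>n\<close>.\<close>

lemma sat_t_halting_fm:
  assumes "infinite (UNIV :: 'd::linorder set)"
  shows "sat_t TYPE('d) (TAnd (halting_fm q) (TEqXi 0 n 1)) \<longleftrightarrow> reval q [n] 0"
proof
  assume "sat_t TYPE('d) (TAnd (halting_fm q) (TEqXi 0 n 1))"
  then have "\<exists>s'. s' \<in> exec (halting_program q) ((\<lambda>_. 0)(0 := n))"
    unfolding sat_t_def halting_fm_def Let_def by (auto intro: program_fm_sound simp del: holds_t.simps)
  then show "reval q [n] 0" by (simp add: exec_halting_program split: if_splits)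
next
  assume "reval q [n] 0"
  then show "sat_t TYPE('d) (TAnd (halting_fm q) (TEqXi 0 n 1))"
    unfolding sat_t_def halting_fm_def Let_def
    by (intro program_fm_complete[OF assms]) (simp add: exec_halting_program)
qed

section \<open>Embedding of the fragment into the full logic\<close>

primrec lrc_of_lrct :: "lrct \<Rightarrow> lrc" where
  "lrc_of_lrct (TEqXi x k y) = EqXi x k y"
| "lrc_of_lrct (TEqXF x y) = EqTest x (EqXi 0 0 0) y"
| "lrc_of_lrct (TEqXFinv x y) = EqTestInv x (EqXi 0 0 0) y"
| "lrc_of_lrct (TLtXF x y) = LtXF x y"
| "lrc_of_lrct (TGtXF x y) = GtXF x y"
| "lrc_of_lrct (TAnd \<phi> \<psi>) = And (lrc_of_lrct \<phi>) (lrc_of_lrct \<psi>)"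
| "lrc_of_lrct (TNot \<phi>) = Not (lrc_of_lrct \<phi>)"
| "lrc_of_lrct (TNext \<phi>) = Next (lrc_of_lrct \<phi>)"
| "lrc_of_lrct (TUntil \<phi> \<psi>) = Until (lrc_of_lrct \<phi>) (lrc_of_lrct \<psi>)"

lemma holds_lrc_of_lrct: "holds \<sigma> i (lrc_of_lrct \<phi>) \<longleftrightarrow> holds_t \<sigma> i \<phi>"
  by (induction \<phi> arbitrary: i) auto

lemma sat_lrc_of_lrct: "sat TYPE('d::linorder) (lrc_of_lrct \<phi>) \<longleftrightarrow> sat_t TYPE('d) \<phi>"
  by (simp add: sat_def sat_t_def holds_lrc_of_lrct)

text \<open>For a decision procedure \<open>f\<close>, take \<open>q\<close> to be \<open>f\<close>
  after \<open>rf_diag\<close>. The resulting \<open>a\<close> satisfies \<open>P\<close> iff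
  \<open>f\<close> returns 0 on the code of \<open>a\<close>, that is, iff \<open>a\<close> does not
  satisfy \<open>P\<close>.\<close>

lemma undecidable_by_diagonalization:
  assumes "\<And>q. \<exists>n a. enc a = prod_encode (5, prod_encode (n, prod_encode (0, enc3 0 n 1))) \<and>
    (P a \<longleftrightarrow> reval q [n] 0)"
  shows "\<not> decidable_pred enc P"
proof
  assume "decidable_pred enc P"
  then obtain f where f: "\<And>a. reval f [enc a] (if P a then 1 else 0)"
    by (auto simp: decidable_pred_def)
  obtain n a where a: "enc a = prod_encode (5, prod_encode (n, prod_encode (0, enc3 0 n 1)))"
    "P a \<longleftrightarrow> reval (Comp f [rf_diag]) [n] 0"
    using assms by blast
  have "P a \<longleftrightarrow> reval f [enc a] 0"
    unfolding a(2) reval_Comp1_iff a(1) using reval_diag[of n] reval_deterministic by blast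
  then show False using f[of a] reval_deterministic by (cases "P a") fastforce+
qed

theorem theorem3p1p1:
  assumes "infinite (UNIV :: 'd::linorder set)"
  shows "\<not> decidable_pred code (sat TYPE('d)) \<and> \<not> decidable_pred code_t (sat_t TYPE('d))"
proof
  show "\<not> decidable_pred code (sat TYPE('d))"
  proof (rule undecidable_by_diagonalization)
    fix q
    \<comment> \<open>Self-reference: the input is the code of the very formula to which the input
      atom is conjoined.\<close>
    let ?n = "code (lrc_of_lrct (halting_fm q))"
    show "\<exists>n a. code a = prod_encode (5, prod_encode (n, prod_encode (0, enc3 0 n 1))) \<and>
        (sat TYPE('d) a \<longleftrightarrow> reval q [n] 0)"
      using sat_t_halting_fm[OF assms, of q ?n]
      by (intro exI[of _ ?n] exI[of _ "lrc_of_lrct (TAnd (halting_fm q) (TEqXi 0 ?n 1))"])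
        (simp only: sat_lrc_of_lrct, simp)
  qed
  show "\<not> decidable_pred code_t (sat_t TYPE('d))"
  proof (rule undecidable_by_diagonalization)
    fix q
    let ?n = "code_t (halting_fm q)"
    show "\<exists>n a. code_t a = prod_encode (5, prod_encode (n, prod_encode (0, enc3 0 n 1))) \<and>
        (sat_t TYPE('d) a \<longleftrightarrow> reval q [n] 0)"
      using sat_t_halting_fm[OF assms, of q ?n]
      by (intro exI[of _ ?n] exI[of _ "TAnd (halting_fm q) (TEqXi 0 ?n 1)"]) simp
  qed
qed

end
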